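(* Let $\mathcal{E}$ be a whole-line CMV matrix with Verblunsky coefficients $\{\alpha_n\}_{n\in\mathbb{Z}}$, $|\alpha_n|\le1$, and let $k\in\mathbb{N}\cup\{\infty\}$. For $n\in\mathbb{Z}$ let $\mu_n$ be the spectral measure of $\mathcal{E}$ and $\delta_n$. Then the following are equivalent: (i) $\mathcal{E}$ belongs to Khrushchev Class with $[\mathcal{E}^\ell]_{n,n}=0$ for $\ell=1,\dots,k-1$ and all $n\in\mathbb{Z}$, and, in the case $k<\infty$, $[\mathcal{E}^k]_{n,n}=c$ for some $c\in\overline{\mathbb{D}}\setminus\{0\}$ and all $n\in\mathbb{Z}$. (ii) For $\ell=1,\dots,k-1$, $\int_0^{2\pi}e^{i\ell\theta}\,d\mu_n(\theta)=0$ for all $n\in\mathbb{Z}$, and, if $k<\infty$, then additionally, for some $c\in\overline{\mathbb{D}}\setminus\{0\}$, $\int_0^{2\pi}e^{ik\theta}\,d\mu_n(\theta)=c$ for all $n\in\mathbb{Z}$. (iii) There exist $n_0\in\mathbb{Z}$, $a,b\in(0,1]$ and $t\in[0,2\pi)$ such that, in the case $k<\infty$, for all $n\in\mathbb{Z}$ and $j=1,\dots,k-1$, $$|\alpha_{n_0+2nk}|=a,\quad |\alpha_{n_0+(2n+1)k}|=b,\quad \alpha_{n_0+nk+j}=0,\quad \arg(\overline{\alpha_{n_0+(n+1)k}}\,\alpha_{n_0+nk})=t,$$ and, in the case $k=\infty$, $\alpha_j=0$ for all $j\in\mathbb{Z}\setminus\{n_0\}$. (When $k=\infty$, "$\ell=1,\dots,k-1$"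 means all $\ell\in\mathbb{N}$; when $k=1$ the corresponding ranges are empty.)
   Context: $\mathbb{N}=\{1,2,\dots\}$ and $\mathbb{D}$ is the open unit disc. Given $\{\alpha_n\}_{n\in\mathbb{Z}}$ with $|\alpha_n|\le1$, the whole-line CMV matrix is the unitary operator $\mathcal{E}=\mathcal{L}\mathcal{M}$ on $\ell^2(\mathbb{Z})$, where $\mathcal{L}$ is the direct sum over $k\in\mathbb{Z}$ of the blocks $\Theta_{2k}$ acting on coordinates $2k,2k+1$, $\mathcal{M}$ is the direct sum of the blocks $\Theta_{2k-1}$ acting on coordinates $2k-1,2k$, and $\Theta_k=\begin{pmatrix}\bar\alpha_k&\rho_k\\ \rho_k&-\alpha_k\end{pmatrix}$, $\rho_k=(1-|\alpha_k|^2)^{1/2}$. The spectral measure $\mu_n$ of $\mathcal{E}$ and the standard basis vector $\delta_n$ is the probability measure on $\partial\mathbb{D}\cong[0,2\pi)$ with $\int e^{i\ell\theta}d\mu_n(\theta)=[\mathcal{E}^\ell]_{n,n}=\langle\delta_n,\mathcal{E}^\ell\delta_n\rangle$ for all $\ell\in\mathbb{Z}$. $\mathcal{E}$ belongs to Khrushchev Class if $\mu_n=\mu_m$ for all $n,m\in\mathbb{Z}$. *)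

theory Defs
  imports "HOL-Probability.Probability" "HOL-Library.Extended_Nat"
begin

section \<open>The Hilbert space of square-summable two-sided sequences\<close>

definition ell2 :: "(int \<Rightarrow> complex) set" where
  "ell2 = {x. (\<lambda>n. (cmod (x n))\<^sup>2) summable_on UNIV}"

definition ell2_inner :: "(int \<Rightarrow> complex) \<Rightarrow> (int \<Rightarrow> complex) \<Rightarrow> complex" where
  "ell2_inner x y = (\<Sum>\<^sub>\<infinity>n. cnj (x n) * y n)"

definition delta :: "int \<Rightarrow> int \<Rightarrow> complex" where
  "delta n = (\<lambda>m. if m = n then 1 else 0)"

definition entry :: "((int \<Rightarrow> complex) \<Rightarrow> (int \<Rightarrow> complex)) \<Rightarrow> int \<Rightarrow> int \<Rightarrow> complex" where
  "entry T m n = ell2_inner (delta m) (T (delta n))"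


section \<open>Whole-line CMV matrices\<close>

definition rho :: "complex \<Rightarrow> real" where
  "rho a = sqrt (1 - (cmod a)\<^sup>2)"

text \<open>
  The direct sum of the blocks \<open>\<Theta>\<^sub>k\<close>, with rows \<open>(cnj (\<alpha> k), rho (\<alpha> k))\<close> and
  \<open>(rho (\<alpha> k), - \<alpha> k)\<close>, acting on the coordinates \<open>k, k+1\<close>, where \<open>k\<close> ranges over the integers
  of one parity \<open>P\<close>.  Being banded, these operators and \<open>cmv \<alpha>\<close> below make sense, and are
  bijective, on arbitrary two-sided sequences; \<open>unitary_on_ell2_cmv\<close> shows that \<open>cmv \<alpha>\<close> restricts
  to a unitary operator on \<open>ell2\<close>.
\<close>

definition theta_sum ::
    "(int \<Rightarrow> bool) \<Rightarrow> (int \<Rightarrow> complex) \<Rightarrow> (int \<Rightarrow> complex) \<Rightarrow> (int \<Rightarrow> complex)" where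
  "theta_sum P \<alpha> x =
    (\<lambda>n. if P n then cnj (\<alpha> n) * x n + complex_of_real (rho (\<alpha> n)) * x (n + 1)
          else complex_of_real (rho (\<alpha> (n - 1))) * x (n - 1) - \<alpha> (n - 1) * x n)"

definition cmv_L :: "(int \<Rightarrow> complex) \<Rightarrow> (int \<Rightarrow> complex) \<Rightarrow> (int \<Rightarrow> complex)" where
  "cmv_L = theta_sum even"

definition cmv_M :: "(int \<Rightarrow> complex) \<Rightarrow> (int \<Rightarrow> complex) \<Rightarrow> (int \<Rightarrow> complex)" where
  "cmv_M = theta_sum odd"

definition cmv :: "(int \<Rightarrow> complex) \<Rightarrow> (int \<Rightarrow> complex) \<Rightarrow> (int \<Rightarrow> complex)" where
  "cmv \<alpha> = cmv_L \<alpha> \<circ> cmv_M \<alpha>"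

definition int_power ::
    "((int \<Rightarrow> complex) \<Rightarrow> (int \<Rightarrow> complex)) \<Rightarrow> int \<Rightarrow> (int \<Rightarrow> complex) \<Rightarrow> (int \<Rightarrow> complex)" where
  "int_power T l = (if l \<ge> 0 then T ^^ nat l else (inv T) ^^ nat (- l))"


section \<open>Spectral measures and Khrushchev Class\<close>

text \<open>
  The circle is identified with \<open>[0, 2\<pi>)\<close>.  For a unitary operator, existence of the measure is
  the spectral theorem (or Herglotz' theorem), and uniqueness holds since trigonometric
  polynomials are dense in the continuous functions on the circle.
\<close>

definition is_spectral_measure ::
    "((int \<Rightarrow> complex) \<Rightarrow> (int \<Rightarrow> complex)) \<Rightarrow> int \<Rightarrow> real measure \<Rightarrow> bool" where
  "is_spectral_measure T n \<mu> \<longleftrightarrow>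
     prob_space \<mu> \<and> sets \<mu> = sets (restrict_space borel {0..<2 * pi}) \<and>
     (\<forall>l::int. (\<integral>\<theta>. cis (of_int l * \<theta>) \<partial>\<mu>) = entry (int_power T l) n n)"

definition spectral_measure ::
    "((int \<Rightarrow> complex) \<Rightarrow> (int \<Rightarrow> complex)) \<Rightarrow> int \<Rightarrow> real measure" where
  "spectral_measure T n = (THE \<mu>. is_spectral_measure T n \<mu>)"

definition khrushchev_class :: "((int \<Rightarrow> complex) \<Rightarrow> (int \<Rightarrow> complex)) \<Rightarrow> bool" where
  "khrushchev_class T \<longleftrightarrow> (\<forall>n m. spectral_measure T n = spectral_measure T m)"


section \<open>Unitarity\<close>

definition unitary_on_ell2 :: "((int \<Rightarrow> complex) \<Rightarrow> (int \<Rightarrow> complex)) \<Rightarrow> bool" where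
  "unitary_on_ell2 T \<longleftrightarrow>
     (\<forall>x\<in>ell2. \<forall>y\<in>ell2. \<forall>c. T (\<lambda>n. c * x n + y n) = (\<lambda>n. c * T x n + T y n)) \<and>
     bij_betw T ell2 ell2 \<and>
     (\<forall>x\<in>ell2. \<forall>y\<in>ell2. ell2_inner (T x) (T y) = ell2_inner x y)"

lemma ell2_inner_delta: "ell2_inner (delta n) x = x n"
proof -
  have "ell2_inner (delta n) x = (\<Sum>\<^sub>\<infinity>m\<in>{n}. x m)"
    unfolding ell2_inner_def delta_def by (rule infsum_cong_neutral) auto
  then show ?thesis by simp
qed

lemma rho_sq:
  assumes "cmod a \<le> 1"
  shows "complex_of_real (rho a) * complex_of_real (rho a) = 1 - a * cnj a"
proof -
  have "(cmod a)\<^sup>2 \<le> 1" using assms by (simp add: power_le_one)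
  then have "rho a * rho a = 1 - (cmod a)\<^sup>2"
    by (simp add: rho_def)
  then have "complex_of_real (rho a * rho a) = 1 - complex_of_real ((cmod a)\<^sup>2)"
    by simp
  then show ?thesis by (simp add: complex_norm_square del: of_real_power)
qed

context
  fixes P :: "int \<Rightarrow> bool"
  assumes alt: "\<And>n. P (n + 1) \<longleftrightarrow> \<not> P n"
begin

lemma alt': "P (n - 1) \<longleftrightarrow> \<not> P n"
  using alt[of "n - 1"] by simp

lemma bij_succ: "bij_betw (\<lambda>n. n + 1) {n. P n} {n. \<not> P n}"
  by (rule bij_betwI[where g = "\<lambda>n. n - 1"]) (auto simp: alt alt')

lemma has_sum_pairs:
  fixes f :: "int \<Rightarrow> 'a :: banach"
  assumes "f summable_on UNIV"
  shows "((\<lambda>n. f n + f (n + 1)) has_sum infsum f UNIV) {n. P n}"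
proof -
  have s: "f summable_on A" for A
    using assms summable_on_subset_banach by blast
  have "((\<lambda>n. f (n + 1)) has_sum infsum f {n. \<not> P n}) {n. P n}"
    using has_sum_reindex_bij_betw[OF bij_succ, of f] has_sum_infsum[OF s] by blast
  then have "((\<lambda>n. f n + f (n + 1)) has_sum (infsum f {n. P n} + infsum f {n. \<not> P n})) {n. P n}"
    by (intro has_sum_add has_sum_infsum s)
  also have "infsum f {n. P n} + infsum f {n. \<not> P n} = infsum f ({n. P n} \<union> {n. \<not> P n})"
    by (rule infsum_Un_disjoint[symmetric]) (auto intro: s)
  also have "{n. P n} \<union> {n. \<not> P n} = UNIV" by auto
  finally show ?thesis .
qed

lemma theta_sum_inverse:
  assumes "\<And>n. cmod (\<alpha> n) \<le> 1"
  shows "theta_sum P (\<lambda>n. cnj (\<alpha> n)) (theta_sum P \<alpha> x) = x"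
proof
  fix n
  have r: "rho (cnj a) = rho a" for a by (simp add: rho_def)
  show "theta_sum P (\<lambda>n. cnj (\<alpha> n)) (theta_sum P \<alpha> x) n = x n"
  proof (cases "P n")
    case True
    then have "theta_sum P (\<lambda>n. cnj (\<alpha> n)) (theta_sum P \<alpha> x) n
        = (\<alpha> n * cnj (\<alpha> n) + complex_of_real (rho (\<alpha> n)) * complex_of_real (rho (\<alpha> n))) * x n"
      by (simp add: theta_sum_def alt r) (simp add: algebra_simps)
    then show ?thesis using rho_sq[OF assms[of n]] by simp
  next
    case False
    then have "theta_sum P (\<lambda>n. cnj (\<alpha> n)) (theta_sum P \<alpha> x) n
        = (\<alpha> (n - 1) * cnj (\<alpha> (n - 1))
           + complex_of_real (rho (\<alpha> (n - 1))) * complex_of_real (rho (\<alpha> (n - 1)))) * x n"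
      by (simp add: theta_sum_def alt' r) (simp add: algebra_simps)
    then show ?thesis using rho_sq[OF assms[of "n - 1"]] by simp
  qed
qed

lemma theta_sum_pair:
  fixes x y :: "int \<Rightarrow> complex"
  assumes "\<And>n. cmod (\<alpha> n) \<le> 1" and "P n"
  defines "T \<equiv> theta_sum P \<alpha>"
  shows "cnj (T x n) * T y n + cnj (T x (n + 1)) * T y (n + 1)
       = cnj (x n) * y n + cnj (x (n + 1)) * y (n + 1)"
proof -
  define r where "r = complex_of_real (rho (\<alpha> n))"
  have r: "r * r = 1 - \<alpha> n * cnj (\<alpha> n)" and rc: "cnj r = r"
    using rho_sq[OF assms(1)] by (simp_all add: r_def)
  have T: "T z n = cnj (\<alpha> n) * z n + r * z (n + 1)" "T z (n + 1) = r * z n - \<alpha> n * z (n + 1)" for z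
    using assms(2) by (simp_all add: T_def theta_sum_def alt r_def)
  have "cnj (T x n) * T y n + cnj (T x (n + 1)) * T y (n + 1)
      = (\<alpha> n * cnj (\<alpha> n) + r * r) * (cnj (x n) * y n + cnj (x (n + 1)) * y (n + 1))"
    by (simp only: T complex_cnj_add complex_cnj_diff complex_cnj_mult complex_cnj_cnj rc)
      (simp add: algebra_simps)
  then show ?thesis by (simp add: r)
qed

lemma theta_sum_ell2:
  assumes "\<And>n. cmod (\<alpha> n) \<le> 1" and "x \<in> ell2"
  shows "theta_sum P \<alpha> x \<in> ell2"
proof -
  define T where "T = theta_sum P \<alpha>"
  define g where "g = (\<lambda>n. (cmod (T x n))\<^sup>2)"
  have "(\<lambda>n. (cmod (x n))\<^sup>2 + (cmod (x (n + 1)))\<^sup>2) summable_on {n. P n}"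
    using has_sum_pairs[of "\<lambda>n. (cmod (x n))\<^sup>2"] assms(2)
    by (auto simp: ell2_def summable_on_def)
  moreover have "(cmod (x n))\<^sup>2 + (cmod (x (n + 1)))\<^sup>2 = g n + g (n + 1)" if "P n" for n
  proof -
    have "complex_of_real (g n + g (n + 1)) = complex_of_real ((cmod (x n))\<^sup>2 + (cmod (x (n + 1)))\<^sup>2)"
      using theta_sum_pair[of \<alpha> n x x, OF assms(1) that]
      by (simp add: g_def T_def complex_norm_square mult.commute del: of_real_power)
    then show ?thesis using of_real_eq_iff by metis
  qed
  ultimately have s: "(\<lambda>n. g n + g (n + 1)) summable_on {n. P n}"
    by (subst summable_on_cong[where g = "\<lambda>n. (cmod (x n))\<^sup>2 + (cmod (x (n + 1)))\<^sup>2"]) auto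
  have "g summable_on {n. P n}"
    by (rule summable_on_comparison_test[OF s]) (auto simp: g_def)
  moreover have "(\<lambda>n. g (n + 1)) summable_on {n. P n}"
    by (rule summable_on_comparison_test[OF s]) (auto simp: g_def)
  then have "g summable_on {n. \<not> P n}"
    using summable_on_reindex_bij_betw[OF bij_succ, of g] by simp
  ultimately have "g summable_on ({n. P n} \<union> {n. \<not> P n})"
    by (rule summable_on_Un_disjoint) auto
  also have "{n. P n} \<union> {n. \<not> P n} = UNIV" by auto
  finally show ?thesis by (simp add: ell2_def g_def T_def)
qed

lemma ell2_inner_summable:
  assumes "x \<in> ell2" and "y \<in> ell2"
  shows "(\<lambda>n. cnj (x n) * y n) summable_on UNIV"
proof (rule abs_summable_summable)
  have "(\<lambda>n. (cmod (x n))\<^sup>2 + (cmod (y n))\<^sup>2) summable_on UNIV"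
    using assms by (auto simp: ell2_def intro: summable_on_add)
  then show "(\<lambda>n. cmod (cnj (x n) * y n)) summable_on UNIV"
  proof (rule summable_on_comparison_test)
    fix n :: int
    have "0 \<le> (cmod (x n) - cmod (y n))\<^sup>2" "0 \<le> cmod (x n) * cmod (y n)" by simp_all
    then show "cmod (cnj (x n) * y n) \<le> (cmod (x n))\<^sup>2 + (cmod (y n))\<^sup>2"
      unfolding power2_diff norm_mult complex_mod_cnj by linarith
  qed simp
qed

lemma unitary_on_ell2_theta_sum:
  assumes "\<And>n. cmod (\<alpha> n) \<le> 1"
  shows "unitary_on_ell2 (theta_sum P \<alpha>)"
  unfolding unitary_on_ell2_def
proof (intro conjI ballI allI)
  fix x y :: "int \<Rightarrow> complex" and c :: complex
  show "theta_sum P \<alpha> (\<lambda>n. c * x n + y n) = (\<lambda>n. c * theta_sum P \<alpha> x n + theta_sum P \<alpha> y n)"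
    by (auto simp: theta_sum_def algebra_simps)
next
  have c: "cmod (cnj (\<alpha> n)) \<le> 1" for n using assms by simp
  show "bij_betw (theta_sum P \<alpha>) ell2 ell2"
    using theta_sum_inverse[OF assms] theta_sum_inverse[OF c]
    by (intro bij_betwI[where g = "theta_sum P (\<lambda>n. cnj (\<alpha> n))"])
       (auto intro: theta_sum_ell2 assms c)
next
  fix x y assume xy: "x \<in> ell2" "y \<in> ell2"
  define T where "T = theta_sum P \<alpha>"
  have Txy: "T x \<in> ell2" "T y \<in> ell2"
    using xy by (auto simp: T_def intro: theta_sum_ell2 assms)
  have "((\<lambda>n. cnj (x n) * y n + cnj (x (n + 1)) * y (n + 1)) has_sum ell2_inner x y) {n. P n}"
    unfolding ell2_inner_def by (rule has_sum_pairs[OF ell2_inner_summable[OF xy]])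
  moreover have "((\<lambda>n. cnj (T x n) * T y n + cnj (T x (n + 1)) * T y (n + 1))
      has_sum ell2_inner (T x) (T y)) {n. P n}"
    unfolding ell2_inner_def by (rule has_sum_pairs[OF ell2_inner_summable[OF Txy]])
  then have "((\<lambda>n. cnj (x n) * y n + cnj (x (n + 1)) * y (n + 1))
      has_sum ell2_inner (T x) (T y)) {n. P n}"
    by (rule has_sum_cong[THEN iffD1, rotated])
       (use theta_sum_pair[of \<alpha>, OF assms] in \<open>simp add: T_def\<close>)
  ultimately show "ell2_inner (theta_sum P \<alpha> x) (theta_sum P \<alpha> y) = ell2_inner x y"
    unfolding T_def by (metis has_sum_unique)
qed

lemma bij_theta_sum:
  assumes "\<And>n. cmod (\<alpha> n) \<le> 1"
  shows "bij (theta_sum P \<alpha>)"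
proof -
  have c: "cmod (cnj (\<alpha> n)) \<le> 1" for n using assms by simp
  show ?thesis
    using theta_sum_inverse[OF assms] theta_sum_inverse[OF c]
    by (intro bij_betwI[where g = "theta_sum P (\<lambda>n. cnj (\<alpha> n))"]) auto
qed

end

lemma unitary_on_ell2_comp:
  assumes "unitary_on_ell2 S" and "unitary_on_ell2 T"
  shows "unitary_on_ell2 (S \<circ> T)"
proof -
  have "T x \<in> ell2" if "x \<in> ell2" for x
    using assms(2) that by (auto simp: unitary_on_ell2_def dest: bij_betwE)
  then show ?thesis
    using assms unfolding unitary_on_ell2_def by (auto intro: bij_betw_trans)
qed

lemma unitary_on_ell2_cmv:
  assumes "\<And>n. cmod (\<alpha> n) \<le> 1"
  shows "unitary_on_ell2 (cmv \<alpha>)"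
  unfolding cmv_def cmv_L_def cmv_M_def
  by (intro unitary_on_ell2_comp unitary_on_ell2_theta_sum assms) simp_all

lemma bij_cmv:
  assumes "\<And>n. cmod (\<alpha> n) \<le> 1"
  shows "bij (cmv \<alpha>)"
  unfolding cmv_def cmv_L_def cmv_M_def
  by (intro bij_comp bij_theta_sum assms) simp_all

end

theory Submission
  imports Defs "HOL-Computational_Algebra.Formal_Power_Series"
begin

text \<open>
  Khrushchev's formula expresses the moments of \<open>\<mu>\<^sub>n\<close> through the Schur functions \<open>f\<^sub>n\<close> and \<open>g\<^sub>n\<close> of
  the right and left half-lines: \<open>\<Sum>\<^sub>l [\<E>\<^sup>l]\<^sub>n\<^sub>n z\<^sup>l = 1 / (1 - z f\<^sub>n g\<^sub>n)\<close>, as formal power series.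
  Hence the conditions on the entries say that \<open>f\<^sub>n g\<^sub>n\<close> vanishes to order \<open>k - 1\<close> with the same
  leading coefficient \<open>c\<close> for all \<open>n\<close>.  If \<open>p\<close> is the first index \<open>\<ge> n\<close> and \<open>q\<close> the last index
  \<open>< n\<close> with nonzero Verblunsky coefficient, then \<open>f\<^sub>n g\<^sub>n = - cnj \<alpha>\<^sub>p \<alpha>\<^sub>q z\<^sup>p\<^sup>-\<^sup>q\<^sup>-\<^sup>1 + \<dots>\<close>, which forces
  consecutive nonzero coefficients to be at distance \<open>k\<close> with \<open>cnj \<alpha>\<^sub>p \<alpha>\<^sub>q = - c\<close>; this is (iii).
  Conversely, (iii) makes \<open>\<alpha>\<close> symmetric, up to conjugation and a unimodular factor, about every
  index \<open>s\<close> with \<open>\<alpha>\<^sub>s \<noteq> 0\<close>.  The symmetry gives \<open>f\<^sub>s\<^sub>+\<^sub>1 g\<^sub>s\<^sub>+\<^sub>1 = f\<^sub>s g\<^sub>s\<close>, an identity which is trivial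
  when \<open>\<alpha>\<^sub>s = 0\<close>.  So \<open>f\<^sub>n g\<^sub>n\<close> does not depend on \<open>n\<close>, and neither does \<open>\<mu>\<^sub>n\<close>.
\<close>

section \<open>Schur functions and Khrushchev's formula\<close>

text \<open>
  The power series \<open>schur \<alpha> n\<close> is the Schur function with parameters
  \<open>cnj (\<alpha> n), cnj (\<alpha> (n + 1)), \<dots>\<close>; comparing coefficients in the Schur algorithm
  \<open>schur_step\<close> determines it recursively.
\<close>

fun schur_coeff :: "(int \<Rightarrow> complex) \<Rightarrow> nat \<Rightarrow> int \<Rightarrow> complex" where
  "schur_coeff \<alpha> 0 n = cnj (\<alpha> n)"
| "schur_coeff \<alpha> (Suc j) n =
     schur_coeff \<alpha> j (n + 1) - \<alpha> n * (\<Sum>i=0..j. schur_coeff \<alpha> i n * schur_coeff \<alpha> (j - i) (n + 1))"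

definition schur :: "(int \<Rightarrow> complex) \<Rightarrow> int \<Rightarrow> complex fps" where
  "schur \<alpha> n = Abs_fps (\<lambda>j. schur_coeff \<alpha> j n)"

lemma schur_nth_0: "fps_nth (schur \<alpha> n) 0 = cnj (\<alpha> n)"
  by (simp add: schur_def)

text \<open>Compare coefficients in degree 0 and in degree \<open>Suc j\<close>. With
  \<open>F\<close> and \<open>G\<close> arbitrary, this serves both existence
  (\<open>schur_step\<close>) and uniqueness (\<open>schur_unique\<close>).\<close>

lemma schur_recursion_iff:
  fixes F G :: "complex fps"
  shows "F * (1 + fps_const a * fps_X * G) = fps_const (cnj a) + fps_X * G \<longleftrightarrow>
    fps_nth F 0 = cnj a \<and>
    (\<forall>j. fps_nth F (Suc j) = fps_nth G j - a * (\<Sum>i=0..j. fps_nth F i * fps_nth G (j - i)))"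
proof -
  have eq: "F * (1 + fps_const a * fps_X * G) = F + fps_const a * (fps_X * (F * G))"
    by (simp add: algebra_simps)
  show ?thesis
    unfolding eq fps_eq_iff
  proof (intro iffI conjI allI; (elim conjE)?)
    fix j
    assume *: "\<forall>n. fps_nth (F + fps_const a * (fps_X * (F * G))) n = fps_nth (fps_const (cnj a) + fps_X * G) n"
    show "fps_nth F 0 = cnj a" using *[rule_format, of 0] by simp
    show "fps_nth F (Suc j) = fps_nth G j - a * (\<Sum>i=0..j. fps_nth F i * fps_nth G (j - i))"
      using *[rule_format, of "Suc j"] by (simp add: fps_mult_nth[of F G] eq_diff_eq)
  next
    fix n
    assume "fps_nth F 0 = cnj a"
      "\<forall>j. fps_nth F (Suc j) = fps_nth G j - a * (\<Sum>i=0..j. fps_nth F i * fps_nth G (j - i))"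
    then show "fps_nth (F + fps_const a * (fps_X * (F * G))) n = fps_nth (fps_const (cnj a) + fps_X * G) n"
      by (cases n) (simp_all add: fps_mult_nth[of F G])
  qed
qed

lemma schur_step:
  "schur \<alpha> n * (1 + fps_const (\<alpha> n) * fps_X * schur \<alpha> (n + 1))
     = fps_const (cnj (\<alpha> n)) + fps_X * schur \<alpha> (n + 1)"
  unfolding schur_recursion_iff by (simp add: schur_def)

text \<open>Coefficient \<open>j\<close> at n depends only on lower coefficients at n and n + 1, so
  the induction on \<open>j\<close> runs over all indices at once. Symmetries of
  \<open>schur\<close> then reduce to checking the Schur step for the transformed family.\<close>

lemma schur_unique:
  assumes "\<And>n. F n * (1 + fps_const (\<alpha> n) * fps_X * F (n + 1))
     = fps_const (cnj (\<alpha> n)) + fps_X * F (n + 1)"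
  shows "F n = schur \<alpha> n"
proof -
  note rec = assms[unfolded schur_recursion_iff]
  have "fps_nth (F n) j = schur_coeff \<alpha> j n" for j n
  proof (induction j arbitrary: n rule: less_induct)
    case (less j)
    then show ?case using rec[of n] by (cases j) simp_all
  qed
  then show ?thesis by (simp add: fps_eq_iff schur_def)
qed

lemma schur_shift: "schur (\<lambda>m. \<alpha> (m + d)) n = schur \<alpha> (n + d)"
  by (rule schur_unique[symmetric, where F = "\<lambda>n. schur \<alpha> (n + d)"])
    (use schur_step[of \<alpha> "_ + d"] in \<open>simp add: add.commute add.left_commute\<close>)

text \<open>In the denominator of the Schur step \<open>c\<close> meets \<open>cnj c\<close> and
  cancels, so the rotation acts on the numerator only.\<close>

lemma schur_scale:
  assumes "cmod c = 1"
  shows "schur (\<lambda>m. c * \<alpha> m) n = fps_const (cnj c) * schur \<alpha> n"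
proof (rule schur_unique[symmetric])
  fix n
  have "fps_const c * fps_const (cnj c) = (1 :: complex fps)"
    using assms by (simp add: complex_norm_square[symmetric])
  then have eq: "fps_const (c * \<alpha> n) * fps_X * (fps_const (cnj c) * schur \<alpha> (n + 1))
      = fps_const (\<alpha> n) * fps_X * schur \<alpha> (n + 1)"
    by (metis (no_types, opaque_lifting) fps_const_mult mult.assoc mult.commute mult.right_neutral)
  have "fps_const (cnj c) * schur \<alpha> n * (1 + fps_const (\<alpha> n) * fps_X * schur \<alpha> (n + 1))
      = fps_const (cnj c) * (fps_const (cnj (\<alpha> n)) + fps_X * schur \<alpha> (n + 1))"
    by (simp only: mult.assoc flip: schur_step)
  then show "fps_const (cnj c) * schur \<alpha> n *
        (1 + fps_const (c * \<alpha> n) * fps_X * (fps_const (cnj c) * schur \<alpha> (n + 1)))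
      = fps_const (cnj (c * \<alpha> n)) + fps_X * (fps_const (cnj c) * schur \<alpha> (n + 1))"
    unfolding eq by (simp add: distrib_left mult.left_commute)
qed

section \<open>Zero parameters and the order of vanishing\<close>

lemma fps_eq_0_if_X_power_dvd:
  fixes F :: "'a::comm_ring_1 fps"
  assumes "\<And>j. fps_X ^ j dvd F"
  shows "F = 0"
proof (rule fps_ext)
  fix j
  obtain q where "F = fps_X ^ Suc j * q" using assms[of "Suc j"] unfolding dvd_def by blast
  then show "fps_nth F j = fps_nth 0 j" by (simp add: fps_X_power_mult_nth del: power_Suc)
qed

lemma schur_zeros:
  assumes "\<And>i. i < p \<Longrightarrow> \<alpha> (n + int i) = 0"
  shows "schur \<alpha> n = fps_X ^ p * schur \<alpha> (n + int p)"
  using assms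
proof (induction p)
  case (Suc p)
  then show ?case
    using schur_step[of \<alpha> "n + int p"] by (simp add: ac_simps)
qed simp

text \<open>Stripping the zeros before the first nonzero parameter leaves a series with nonzero
  constant term; without such a parameter every power of \<open>fps_X\<close> divides.\<close>

lemma schur_eq_0_iff: "schur \<alpha> n = 0 \<longleftrightarrow> (\<forall>m\<ge>n. \<alpha> m = 0)"
proof
  assume *: "schur \<alpha> n = 0"
  show "\<forall>m\<ge>n. \<alpha> m = 0"
  proof (rule ccontr)
    assume "\<not> ?thesis"
    then obtain m where "m \<ge> n" "\<alpha> m \<noteq> 0" by blast
    then have "\<exists>p. \<alpha> (n + int p) \<noteq> 0"
      by (intro exI[of _ "nat (m - n)"]) simp
    then obtain p where p: "\<alpha> (n + int p) \<noteq> 0" "\<And>i. i < p \<Longrightarrow> \<alpha> (n + int i) = 0"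
      using exists_least_iff[of "\<lambda>p. \<alpha> (n + int p) \<noteq> 0"] by blast
    have "schur \<alpha> (n + int p) = 0"
      using schur_zeros[of p \<alpha> n] p(2) * by simp
    then show False using p(1) schur_nth_0[of \<alpha> "n + int p"] by simp
  qed
next
  assume "\<forall>m\<ge>n. \<alpha> m = 0"
  then have "fps_X ^ p dvd schur \<alpha> n" for p
    using schur_zeros[of p \<alpha> n] by simp
  then show "schur \<alpha> n = 0" by (rule fps_eq_0_if_X_power_dvd)
qed

text \<open>Reflecting the index turns the Schur functions of the left half-lines into those of right
  half-lines, here with parameters \<open>- \<alpha> (n - 1), - \<alpha> (n - 2), \<dots>\<close>.\<close>

definition back_schur :: "(int \<Rightarrow> complex) \<Rightarrow> int \<Rightarrow> complex fps" where
  "back_schur \<alpha> n = schur (\<lambda>m. - cnj (\<alpha> (- m - 1))) (- n)"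

lemma back_schur_nth_0: "fps_nth (back_schur \<alpha> n) 0 = - \<alpha> (n - 1)"
  by (simp add: back_schur_def schur_nth_0)

lemma back_schur_step:
  "back_schur \<alpha> (n + 1) * (1 - fps_const (cnj (\<alpha> n)) * fps_X * back_schur \<alpha> n)
     = - fps_const (\<alpha> n) + fps_X * back_schur \<alpha> n"
  using schur_step[of "\<lambda>m. - cnj (\<alpha> (- m - 1))" "- (n + 1)"]
  by (simp add: back_schur_def flip: fps_const_neg)

lemma back_schur_zeros:
  assumes "\<And>i. i < p \<Longrightarrow> \<alpha> (n - 1 - int i) = 0"
  shows "back_schur \<alpha> n = fps_X ^ p * back_schur \<alpha> (n - int p)"
  using schur_zeros[of p "\<lambda>m. - cnj (\<alpha> (- m - 1))" "- n"] assms
  by (simp add: back_schur_def algebra_simps)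

lemma back_schur_eq_0_iff: "back_schur \<alpha> n = 0 \<longleftrightarrow> (\<forall>m<n. \<alpha> m = 0)"
proof -
  have "(\<forall>m\<ge>-n. \<alpha> (- m - 1) = 0) \<longleftrightarrow> (\<forall>m<n. \<alpha> m = 0)"
  proof (intro iffI allI impI)
    fix m assume "\<forall>m\<ge>-n. \<alpha> (- m - 1) = 0" "m < n"
    from this(1)[rule_format, of "- m - 1"] this(2) show "\<alpha> m = 0" by simp
  qed simp
  then show ?thesis by (simp add: back_schur_def schur_eq_0_iff)
qed

text \<open>Reflection about \<open>s\<close> turns the parameters of the left half-line into those
  of a right half-line, up to the unimodular factor \<open>- cnj c\<close>; shifting and rotating do
  the rest.\<close>

lemma back_schur_reflect:
  assumes "cmod c = 1" and "\<And>j. \<alpha> (s - j) = c * cnj (\<alpha> (s + j))"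
  shows "back_schur \<alpha> n = - fps_const c * schur \<alpha> (2 * s + 1 - n)"
proof -
  have "\<alpha> (- m - 1) = c * cnj (\<alpha> (m + (2 * s + 1)))" for m
  proof -
    have "s - (m + s + 1) = - m - 1" "s + (m + s + 1) = m + (2 * s + 1)" by simp_all
    then show ?thesis using assms(2)[of "m + s + 1"] by metis
  qed
  then have "(\<lambda>m. - cnj (\<alpha> (- m - 1))) = (\<lambda>m. (- cnj c) * \<alpha> (m + (2 * s + 1)))"
    by simp
  then have "back_schur \<alpha> n = fps_const (cnj (- cnj c)) * schur (\<lambda>m. \<alpha> (m + (2 * s + 1))) (- n)"
    unfolding back_schur_def using schur_scale[of "- cnj c" "\<lambda>m. \<alpha> (m + (2 * s + 1))" "- n"] assms(1) by simp
  then show ?thesis by (simp add: schur_shift algebra_simps flip: fps_const_neg)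
qed

text \<open>Every two steps gain a factor \<open>fps_X\<close>, so all its powers divide. The
  hypothesis spans two steps because a single block may carry no time delay.\<close>

lemma fps_eq_0_if_contracting:
  fixes e b :: "nat \<Rightarrow> complex fps"
  assumes "\<And>m. fps_X dvd b m * b (Suc m)" and "\<And>m. e m = b m * e (Suc m)"
  shows "e m = 0"
proof (rule fps_eq_0_if_X_power_dvd)
  fix j show "fps_X ^ j dvd e m"
  proof (induction j arbitrary: m)
    case (Suc j)
    have "e m = b m * b (Suc m) * e (Suc (Suc m))"
      using assms(2)[of m] assms(2)[of "Suc m"] by (simp add: mult.assoc)
    then show ?case using Suc assms(1) by (metis mult_dvd_mono power_Suc)
  qed simp
qed

lemma fps_const_rho_sq:
  assumes "cmod a \<le> 1"
  shows "fps_const (complex_of_real (rho a)) * fps_const (complex_of_real (rho a))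
    = 1 - fps_const a * fps_const (cnj a)"
  using rho_sq[OF assms] by (simp add: fps_const_mult flip: fps_const_sub)

lemma theta_sum_pair_eqs:
  assumes "P n" "\<not> P (n + 1)"
  shows "theta_sum P \<alpha> x n = cnj (\<alpha> n) * x n + complex_of_real (rho (\<alpha> n)) * x (n + 1)"
    "theta_sum P \<alpha> x (n + 1) = complex_of_real (rho (\<alpha> n)) * x n - \<alpha> n * x (n + 1)"
  using assms by (simp_all add: theta_sum_def)

definition moment_fps :: "(int \<Rightarrow> complex) \<Rightarrow> int \<Rightarrow> complex fps" where
  "moment_fps \<alpha> n = Abs_fps (\<lambda>l. entry (cmv \<alpha> ^^ l) n n)"

text \<open>
  Khrushchev's formula.  The blocks \<open>\<Theta>\<^sub>m\<close> are read as scatterers between neighbouring sites,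
  with \<open>u\<close> and \<open>v\<close> the generating functions of the amplitudes of \<open>cmv \<alpha> ^^ l\<close> at integer and at
  half-integer times.  At site \<open>m\<close>, \<open>R m\<close> is the amplitude moving right (about to hit \<open>\<Theta>\<^sub>m\<close>) and
  \<open>S m\<close> the one moving left (about to hit \<open>\<Theta>\<^sub>m\<^sub>-\<^sub>1\<close>).  To the right of the source the half-line
  reflects \<open>R m\<close> into \<open>S m\<close> with reflection coefficient \<open>schur \<alpha> m\<close>: the defect \<open>eS\<close> at \<open>m\<close> is a
  multiple of the one at \<open>m + 1\<close>, gaining a factor \<open>fps_X\<close> every two steps, so it vanishes.
\<close>

lemma moment_fps_eq:
  assumes \<alpha>: "\<And>n. cmod (\<alpha> n) \<le> 1"
  shows "moment_fps \<alpha> n * (1 - fps_X * (schur \<alpha> n * back_schur \<alpha> n)) = 1"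
proof -
  define x where "x l = (cmv \<alpha> ^^ l) (delta n)" for l
  have x_0: "x 0 = delta n" and x_Suc: "x (Suc l) = cmv_L \<alpha> (cmv_M \<alpha> (x l))" for l
    by (simp_all add: x_def cmv_def)
  define u where "u m = Abs_fps (\<lambda>l. x l m)" for m
  define v where "v m = Abs_fps (\<lambda>l. cmv_M \<alpha> (x l) m)" for m
  define a b r where "a m = fps_const (\<alpha> m)" and "b m = fps_const (cnj (\<alpha> m))"
    and "r m = fps_const (complex_of_real (rho (\<alpha> m)))" for m
  define D where "D m = (if m = n then 1 else 0 :: complex fps)" for m
  have rr: "r m * r m = 1 - a m * b m" for m
    unfolding a_def b_def r_def by (rule fps_const_rho_sq) (rule \<alpha>)
  have v1: "v m = b m * u m + r m * u (m + 1)" "v (m + 1) = r m * u m - a m * u (m + 1)"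
    if "odd m" for m
    using that theta_sum_pair_eqs[of odd m \<alpha>]
    by (auto simp: fps_eq_iff v_def u_def a_def b_def r_def cmv_M_def)
  have u1: "u m = D m + fps_X * (b m * v m + r m * v (m + 1))"
      "u (m + 1) = D (m + 1) + fps_X * (r m * v m - a m * v (m + 1))"
    if "even m" for m
  proof -
    have *: "fps_nth (u m') l = fps_nth (D m') l + (if l = 0 then 0 else cmv_L \<alpha> (cmv_M \<alpha> (x (l - 1))) m')" for l m'
      by (cases l) (simp_all add: u_def D_def x_0 x_Suc delta_def)
    show "u m = D m + fps_X * (b m * v m + r m * v (m + 1))"
      "u (m + 1) = D (m + 1) + fps_X * (r m * v m - a m * v (m + 1))"
      using that theta_sum_pair_eqs[of even m \<alpha>]
      by (auto simp: fps_eq_iff * v_def a_def b_def r_def cmv_L_def)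
  qed
  \<comment> \<open>\<open>cmv_M\<close> acts first, with the odd blocks, then \<open>cmv_L\<close>
    with the even ones. So even blocks meet the half-integer amplitudes \<open>v\<close> and odd
    blocks meet \<open>u\<close>; only an even block completes a unit of time, whence
    \<zeta>.\<close>
  define R S where "R m = (if even m then v m else u m)" and "S m = (if even m then u m else v m)" for m
  define \<zeta> where "\<zeta> m = (if even m then fps_X else 1 :: complex fps)" for m :: int
  define f g where "f = schur \<alpha>" and "g = back_schur \<alpha>"
  have f: "f m * (1 + a m * fps_X * f (m + 1)) = b m + fps_X * f (m + 1)" for m
    unfolding f_def a_def b_def by (rule schur_step)
  have g: "g (m + 1) * (1 - b m * fps_X * g m) = - a m + fps_X * g m" for m
    unfolding g_def a_def b_def by (rule back_schur_step)
  \<comment> \<open>The source feeds the integer-time amplitude \<open>u n\<close>, which is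
    left-moving for even n and right-moving for odd n.\<close>
  define DS DR where "DS m = (if even m then D m else 0)" and "DR m = (if even m then 0 else D m)" for m
  have SR: "S m = DS m + \<zeta> m * (b m * R m + r m * S (m + 1))"
      "R (m + 1) = DR (m + 1) + \<zeta> m * (r m * R m - a m * S (m + 1))" for m
    using v1[of m] u1[of m] by (auto simp: S_def R_def DS_def DR_def \<zeta>_def)
  define eS where "eS m = S m - DS m - \<zeta> m * f m * R m" for m
  \<comment> \<open>Left of the source the roles are exchanged: \<open>S m\<close> is reflected into
    \<open>R m\<close> by the block at m - 1, which has the parity of m + 1.\<close>
  define eR where "eR m = R m - DR m - \<zeta> (m + 1) * g m * S m" for m
  have \<zeta>2: "\<zeta> m * \<zeta> (m + 1) = fps_X" for m by (simp add: \<zeta>_def)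
  have eS_step: "(1 + a m * fps_X * f (m + 1)) * eS m = r m * \<zeta> m * eS (m + 1)" if "n \<le> m" for m
  proof -
    define F e where "F = f (m + 1)" and "e = eS (m + 1)"
    have D0: "DS (m + 1) = 0" "DR (m + 1) = 0" using that by (simp_all add: DS_def DR_def D_def)
    have S': "S (m + 1) = \<zeta> (m + 1) * F * R (m + 1) + e" by (simp add: e_def eS_def D0 F_def)
    have R': "R (m + 1) = \<zeta> m * (r m * R m - a m * S (m + 1))" using SR(2)[of m] D0 by simp
    have eS: "eS m = \<zeta> m * (b m * R m + r m * S (m + 1) - f m * R m)"
      unfolding eS_def by (subst SR(1)) (simp add: algebra_simps)
    have S'': "S (m + 1) * (1 + a m * fps_X * F) = fps_X * F * r m * R m + e"
    proof -
      have "S (m + 1) = \<zeta> m * \<zeta> (m + 1) * F * (r m * R m - a m * S (m + 1)) + e"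
        by (subst S', subst R') (simp add: algebra_simps)
      then show ?thesis unfolding \<zeta>2 by (simp add: algebra_simps)
    qed
    have "(1 + a m * fps_X * F) * eS m
        = \<zeta> m * (b m * R m * (1 + a m * fps_X * F) + r m * (S (m + 1) * (1 + a m * fps_X * F))
            - f m * (1 + a m * fps_X * F) * R m)"
      by (subst eS) (simp add: algebra_simps)
    \<comment> \<open>After the Schur step is inserted, the terms in \<open>R m\<close> collect into
      the factor \<open>a m * b m + r m * r m - 1\<close>, which is 0 by unitarity of the
      block.\<close>
    also have "\<dots> = \<zeta> m * (R m * fps_X * F * (a m * b m + r m * r m - 1) + r m * e)"
      unfolding S'' f[of m, folded F_def] by (simp add: algebra_simps)
    finally show ?thesis by (simp add: rr F_def e_def algebra_simps)
  qed
  have eR_step: "(1 - b m * fps_X * g m) * eR (m + 1) = r m * \<zeta> m * eR m" if "m < n" for m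
  proof -
    define G d where "G = g m" and "d = eR m"
    have D0: "DS m = 0" "DR m = 0" using that by (simp_all add: DS_def DR_def D_def)
    have R': "R m = \<zeta> (m + 1) * G * S m + d" by (simp add: d_def eR_def D0 G_def)
    have S': "S m = \<zeta> m * (b m * R m + r m * S (m + 1))" using SR(1)[of m] D0 by simp
    have \<zeta>_per: "\<zeta> (m + 1 + 1) = \<zeta> m" by (simp add: \<zeta>_def)
    have eR: "eR (m + 1) = \<zeta> m * (r m * R m - a m * S (m + 1) - g (m + 1) * S (m + 1))"
      unfolding eR_def \<zeta>_per by (subst SR(2)) (simp add: algebra_simps)
    have R'': "R m * (1 - b m * fps_X * G) = fps_X * G * r m * S (m + 1) + d"
    proof -
      have "R m = \<zeta> m * \<zeta> (m + 1) * G * (b m * R m + r m * S (m + 1)) + d"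
        by (subst R', subst S') (simp add: algebra_simps)
      then show ?thesis unfolding \<zeta>2 by (simp add: algebra_simps)
    qed
    have "(1 - b m * fps_X * G) * eR (m + 1)
        = \<zeta> m * (r m * (R m * (1 - b m * fps_X * G)) - a m * S (m + 1) * (1 - b m * fps_X * G)
            - g (m + 1) * (1 - b m * fps_X * G) * S (m + 1))"
      by (subst eR) (simp add: algebra_simps)
    also have "\<dots> = \<zeta> m * (S (m + 1) * fps_X * G * (a m * b m + r m * r m - 1) + r m * d)"
      unfolding R'' g[of m, folded G_def] by (simp add: algebra_simps)
    finally show ?thesis by (simp add: rr G_def d_def algebra_simps)
  qed
  \<comment> \<open>The Schur denominators have constant term 1; dividing by them brings the defect
    recursions into contracting form.\<close>
  have cancel: "e = inverse p * q * e'" if "p * e = q * e'" "fps_nth p 0 = 1" for p q e e' :: "complex fps"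
  proof -
    have "inverse p * (p * e) = e" using that(2) by (simp add: inverse_mult_eq_1 flip: mult.assoc)
    then show ?thesis using that(1) by (simp add: mult.assoc)
  qed
  have X_dvd: "fps_X dvd p * (q * y) * (p' * (q' * z))" if "y * z = fps_X" for p q y p' q' z :: "complex fps"
    by (subst that[symmetric]) (intro mult_dvd_mono dvd_mult dvd_refl)
  have "eS (n + int 0) = 0"
  proof (rule fps_eq_0_if_contracting[where e = "\<lambda>i. eS (n + int i)"])
    fix i
    define m where "m = n + int i"
    have m: "n + int (Suc i) = m + 1" "n \<le> m" by (simp_all add: m_def)
    show "eS (n + int i) = (inverse (1 + a (n + int i) * fps_X * f (n + int i + 1)) * (r (n + int i) * \<zeta> (n + int i)))
        * eS (n + int (Suc i))"
      unfolding m(1) unfolding m_def[symmetric] by (rule cancel) (use eS_step m in simp_all)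
    show "fps_X dvd (inverse (1 + a (n + int i) * fps_X * f (n + int i + 1)) * (r (n + int i) * \<zeta> (n + int i)))
        * (inverse (1 + a (n + int (Suc i)) * fps_X * f (n + int (Suc i) + 1)) * (r (n + int (Suc i)) * \<zeta> (n + int (Suc i))))"
      unfolding m(1) unfolding m_def[symmetric] by (rule X_dvd[OF \<zeta>2])
  qed
  moreover have "eR (n - int 0) = 0"
  proof (rule fps_eq_0_if_contracting[where e = "\<lambda>i. eR (n - int i)"])
    fix i
    define m where "m = n - int i - 1"
    have m: "n - int (Suc i) = m" "n - int i = m + 1" "m < n" by (simp_all add: m_def)
    show "eR (n - int i) = (inverse (1 - b (n - int (Suc i)) * fps_X * g (n - int (Suc i))) * (r (n - int (Suc i)) * \<zeta> (n - int (Suc i))))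
        * eR (n - int (Suc i))"
      unfolding m by (rule cancel) (use eR_step m in simp_all)
    have "\<zeta> (n - int (Suc i)) * \<zeta> (n - int (Suc (Suc i))) = fps_X"
      using \<zeta>2[of "n - int (Suc (Suc i))"] by (simp add: mult.commute algebra_simps)
    then show "fps_X dvd (inverse (1 - b (n - int (Suc i)) * fps_X * g (n - int (Suc i))) * (r (n - int (Suc i)) * \<zeta> (n - int (Suc i))))
        * (inverse (1 - b (n - int (Suc (Suc i))) * fps_X * g (n - int (Suc (Suc i)))) * (r (n - int (Suc (Suc i))) * \<zeta> (n - int (Suc (Suc i)))))"
      by (rule X_dvd)
  qed
  \<comment> \<open>At the source both half-line relations hold. Eliminating the amplitude other
    than \<open>u n\<close> closes the equation, and the two factors \<zeta> combine into one
    \<open>fps_X\<close>.\<close>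
  ultimately have *: "S n = DS n + \<zeta> n * f n * R n" "R n = DR n + \<zeta> (n + 1) * g n * S n"
    by (simp_all add: eS_def eR_def algebra_simps)
  have "u n = 1 + fps_X * (f n * g n) * u n"
  proof (cases "even n")
    case True
    then show ?thesis using * by (simp add: S_def R_def DS_def DR_def \<zeta>_def D_def mult.assoc)
  next
    case False
    then show ?thesis using * by (simp add: S_def R_def DS_def DR_def \<zeta>_def D_def ac_simps)
  qed
  moreover have "u n = moment_fps \<alpha> n"
    by (simp add: u_def moment_fps_def x_def entry_def ell2_inner_delta)
  ultimately show ?thesis by (simp add: f_def g_def algebra_simps)
qed

section \<open>Vanishing moments and sparse coefficients\<close>

lemma entry_power_0: "entry (T ^^ 0) n n = 1"
  by (simp add: entry_def ell2_inner_delta) (simp add: delta_def)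

text \<open>Khrushchev's formula, solved for the moment series as
  \<open>M = 1 + fps_X * (f * g * M)\<close>, is a renewal equation for the diagonal
  entries.\<close>

lemma moment_fps_nth_Suc:
  assumes \<alpha>: "\<And>n. cmod (\<alpha> n) \<le> 1"
  shows "entry (cmv \<alpha> ^^ Suc l) n n
    = (\<Sum>i=0..l. fps_nth (schur \<alpha> n * back_schur \<alpha> n) i * entry (cmv \<alpha> ^^ (l - i)) n n)"
proof -
  have "moment_fps \<alpha> n = 1 + fps_X * (schur \<alpha> n * back_schur \<alpha> n * moment_fps \<alpha> n)"
    using moment_fps_eq[of \<alpha> n, OF \<alpha>] by (simp add: algebra_simps)
  from arg_cong[OF this, of "\<lambda>F. fps_nth F (Suc l)"] show ?thesis
    by (simp add: fps_mult_nth[of "schur \<alpha> n * back_schur \<alpha> n"] moment_fps_def del: funpow.simps)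
qed

lemma entry_cong_if_schur_product_eq:
  assumes \<alpha>: "\<And>n. cmod (\<alpha> n) \<le> 1"
    and H: "schur \<alpha> n * back_schur \<alpha> n = schur \<alpha> m * back_schur \<alpha> m"
  shows "entry (cmv \<alpha> ^^ l) n n = entry (cmv \<alpha> ^^ l) m m"
proof -
  define D where "D = 1 - fps_X * (schur \<alpha> m * back_schur \<alpha> m)"
  have n: "moment_fps \<alpha> n * D = 1" and m: "moment_fps \<alpha> m * D = 1"
    using moment_fps_eq[of \<alpha> n, OF \<alpha>] moment_fps_eq[of \<alpha> m, OF \<alpha>] by (simp_all only: H D_def)
  have "moment_fps \<alpha> n = moment_fps \<alpha> n * (moment_fps \<alpha> m * D)" by (simp only: m mult_1_right)
  also have "\<dots> = moment_fps \<alpha> m * (moment_fps \<alpha> n * D)" by (simp only: mult.left_commute)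
  finally have "moment_fps \<alpha> n = moment_fps \<alpha> m" by (simp only: n mult_1_right)
  from arg_cong[OF this, of "\<lambda>F. fps_nth F l"] show ?thesis by (simp add: moment_fps_def)
qed

text \<open>If the first N coefficients of the product vanish, only the term with the zeroth power,
  whose entry is 1, survives in the renewal equation. So entry N + 1 equals coefficient N, which
  explains the shift by one.\<close>

lemma entries_vanish_iff:
  assumes \<alpha>: "\<And>n. cmod (\<alpha> n) \<le> 1"
  shows "(\<forall>l. 1 \<le> l \<and> l \<le> N \<longrightarrow> entry (cmv \<alpha> ^^ l) n n = 0)
    \<longleftrightarrow> (\<forall>i<N. fps_nth (schur \<alpha> n * back_schur \<alpha> n) i = 0)"
    (is "?L N \<longleftrightarrow> ?R N")
proof (induction N)
  case (Suc N)
  have "entry (cmv \<alpha> ^^ Suc N) n n = fps_nth (schur \<alpha> n * back_schur \<alpha> n) N" if "?R N"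
    unfolding moment_fps_nth_Suc[of \<alpha>, OF \<alpha>] using that entry_power_0[of "cmv \<alpha>" n]
    by (simp add: atLeast0AtMost lessThan_Suc_atMost[symmetric] del: funpow.simps)
  then show ?case
    using Suc by (auto simp: le_Suc_eq less_Suc_eq simp del: funpow.simps)
qed auto

lemma entry_Suc_leading:
  assumes \<alpha>: "\<And>n. cmod (\<alpha> n) \<le> 1"
    and "\<And>i. i < N \<Longrightarrow> fps_nth (schur \<alpha> n * back_schur \<alpha> n) i = 0"
  shows "entry (cmv \<alpha> ^^ Suc N) n n = fps_nth (schur \<alpha> n * back_schur \<alpha> n) N"
  unfolding moment_fps_nth_Suc[of \<alpha>, OF \<alpha>] using assms(2) entry_power_0[of "cmv \<alpha>" n]
  by (simp add: atLeast0AtMost lessThan_Suc_atMost[symmetric] del: funpow.simps)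

section \<open>Invariance and leading term of the product of Schur functions\<close>

lemma schur_product_step:
  assumes "cmod c = 1" and "\<And>j. \<alpha> (s - j) = c * cnj (\<alpha> (s + j))"
  shows "schur \<alpha> (s + 1) * back_schur \<alpha> (s + 1) = schur \<alpha> s * back_schur \<alpha> s"
  using back_schur_reflect[of c \<alpha> s "s + 1", OF assms] back_schur_reflect[of c \<alpha> s s, OF assms]
  by (simp add: algebra_simps)

text \<open>Both products equal
  \<open>fps_X * schur \<alpha> (s + 1) * back_schur \<alpha> s\<close>.\<close>

lemma schur_product_step_zero:
  assumes "\<alpha> s = 0"
  shows "schur \<alpha> (s + 1) * back_schur \<alpha> (s + 1) = schur \<alpha> s * back_schur \<alpha> s"
  using schur_step[of \<alpha> s] back_schur_step[of \<alpha> s] assms by (simp add: ac_simps)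

lemma int_shift_invariant_const:
  fixes f :: "int \<Rightarrow> 'a"
  assumes "\<And>s. f (s + 1) = f s"
  shows "f n = f m"
proof -
  have "f n = f 0" for n
    by (induction n rule: int_induct[where k = 0]) (use assms[of "_ - 1"] assms in auto)
  then show ?thesis by metis
qed

text \<open>The p - n zeros from n upwards and the n - q - 1 zeros below n each give a factor
  \<open>fps_X\<close>; their total does not depend on n.\<close>

lemma schur_product_between_zeros:
  assumes "q < n" "n \<le> p" and "\<And>j. q < j \<Longrightarrow> j < p \<Longrightarrow> \<alpha> j = 0"
  shows "schur \<alpha> n * back_schur \<alpha> n
    = fps_X ^ nat (p - q - 1) * (schur \<alpha> p * back_schur \<alpha> (q + 1))"
proof -
  have "schur \<alpha> n = fps_X ^ nat (p - n) * schur \<alpha> p"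
    using schur_zeros[of "nat (p - n)" \<alpha> n] assms by simp
  moreover have "back_schur \<alpha> n = fps_X ^ nat (n - q - 1) * back_schur \<alpha> (q + 1)"
    using back_schur_zeros[of "nat (n - q - 1)" \<alpha> n] assms by simp
  moreover have "nat (p - q - 1) = nat (p - n) + nat (n - q - 1)" using assms by simp
  ultimately show ?thesis by (simp add: power_add)
qed

lemma nonzero_neighbours:
  assumes "schur \<alpha> n * back_schur \<alpha> n \<noteq> 0"
  shows "\<exists>p q. q < n \<and> n \<le> p \<and> \<alpha> p \<noteq> 0 \<and> \<alpha> q \<noteq> 0 \<and> (\<forall>j. q < j \<and> j < p \<longrightarrow> \<alpha> j = 0)"
proof -
  obtain p' q' where p': "p' \<ge> n" "\<alpha> p' \<noteq> 0" and q': "q' < n" "\<alpha> q' \<noteq> 0"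
    using assms schur_eq_0_iff[of \<alpha> n] back_schur_eq_0_iff[of \<alpha> n] by auto
  have "\<exists>i. \<alpha> (n + int i) \<noteq> 0" using p' by (intro exI[of _ "nat (p' - n)"]) simp
  then obtain i where i: "\<alpha> (n + int i) \<noteq> 0" "\<And>i'. i' < i \<Longrightarrow> \<alpha> (n + int i') = 0"
    using exists_least_iff[of "\<lambda>i. \<alpha> (n + int i) \<noteq> 0"] by blast
  have "\<exists>i. \<alpha> (n - 1 - int i) \<noteq> 0" using q' by (intro exI[of _ "nat (n - 1 - q')"]) simp
  then obtain k where k: "\<alpha> (n - 1 - int k) \<noteq> 0" "\<And>i'. i' < k \<Longrightarrow> \<alpha> (n - 1 - int i') = 0"
    using exists_least_iff[of "\<lambda>i. \<alpha> (n - 1 - int i) \<noteq> 0"] by blast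
  show ?thesis
  proof (rule exI[of _ "n + int i"], rule exI[of _ "n - 1 - int k"], intro conjI allI impI)
    fix j assume "n - 1 - int k < j \<and> j < n + int i"
    then show "\<alpha> j = 0"
      using i(2)[of "nat (j - n)"] k(2)[of "nat (n - 1 - j)"] by (cases "n \<le> j") simp_all
  qed (use i k in simp_all)
qed

text \<open>The factors left after removing the zeros have constant terms
  \<open>cnj (\<alpha> p)\<close> and \<open>- \<alpha> q\<close>, both nonzero, so the order is
  exactly p - q - 1.\<close>

lemma schur_product_leading:
  assumes "schur \<alpha> n * back_schur \<alpha> n \<noteq> 0"
  shows "\<exists>p q. q < n \<and> n \<le> p \<and> \<alpha> p \<noteq> 0 \<and> \<alpha> q \<noteq> 0 \<and> (\<forall>j. q < j \<and> j < p \<longrightarrow> \<alpha> j = 0) \<and>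
    (\<forall>i < nat (p - q - 1). fps_nth (schur \<alpha> n * back_schur \<alpha> n) i = 0) \<and>
    fps_nth (schur \<alpha> n * back_schur \<alpha> n) (nat (p - q - 1)) = - cnj (\<alpha> p) * \<alpha> q"
proof -
  from nonzero_neighbours[OF assms] obtain p q where
    *: "q < n" "n \<le> p" "\<alpha> p \<noteq> 0" "\<alpha> q \<noteq> 0" "\<forall>j. q < j \<and> j < p \<longrightarrow> \<alpha> j = 0" by blast
  have H: "schur \<alpha> n * back_schur \<alpha> n
      = fps_X ^ nat (p - q - 1) * (schur \<alpha> p * back_schur \<alpha> (q + 1))"
    using * by (intro schur_product_between_zeros) auto
  show ?thesis
    by (rule exI[of _ p], rule exI[of _ q])
      (use * in \<open>simp add: H fps_X_power_mult_nth schur_nth_0 back_schur_nth_0\<close>)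
qed

section \<open>Periodic sparse coefficients\<close>

text \<open>Condition (iii) for finite \<open>k\<close>, with \<open>a b cis t\<close> combined into \<open>\<kappa>\<close>
  (see \<open>sparse_periodic_cond\<close>).\<close>

definition sparse_periodic :: "(int \<Rightarrow> complex) \<Rightarrow> nat \<Rightarrow> int \<Rightarrow> complex \<Rightarrow> bool" where
  "sparse_periodic \<alpha> K s\<^sub>0 \<kappa> \<longleftrightarrow>
    \<kappa> \<noteq> 0 \<and> (\<forall>m. cnj (\<alpha> (s\<^sub>0 + (m + 1) * int K)) * \<alpha> (s\<^sub>0 + m * int K) = \<kappa>) \<and>
    (\<forall>j. \<not> int K dvd j \<longrightarrow> \<alpha> (s\<^sub>0 + j) = 0)"

lemma sparse_periodic_zero:
  assumes "sparse_periodic \<alpha> K s\<^sub>0 \<kappa>" and "\<not> int K dvd s - s\<^sub>0"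
  shows "\<alpha> s = 0"
proof -
  have "\<alpha> (s\<^sub>0 + (s - s\<^sub>0)) = 0"
    using assms unfolding sparse_periodic_def by blast
  then show ?thesis by simp
qed

text \<open>On the sublattice, neighbouring values determine each other through \<kappa>, so
  symmetry at the centre spreads outwards step by step; off the sublattice both sides are 0.\<close>

lemma sparse_periodic_reflect:
  assumes sp: "sparse_periodic \<alpha> K s\<^sub>0 \<kappa>"
  obtains c where "cmod c = 1" "\<And>j. \<alpha> (s\<^sub>0 + m * int K - j) = c * cnj (\<alpha> (s\<^sub>0 + m * int K + j))"
proof -
  define \<beta> where "\<beta> m = \<alpha> (s\<^sub>0 + m * int K)" for m
  have \<kappa>: "\<kappa> \<noteq> 0" and \<beta>: "cnj (\<beta> (m + 1)) * \<beta> m = \<kappa>" for m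
    using sp by (simp_all add: sparse_periodic_def \<beta>_def)
  have nz: "\<beta> m \<noteq> 0" for m using \<kappa> \<beta>[of m] by auto
  define c where "c = \<beta> m / cnj (\<beta> m)"
  have c: "cmod c = 1" using nz[of m] by (simp add: c_def norm_divide)
  then have cc: "c * cnj c = 1" by (simp add: complex_norm_square[symmetric])
  \<comment> \<open>For unimodular \<open>c\<close> the relation is symmetric, so the symmetry at j
    gives the one at -j.\<close>
  have swap: "y = c * cnj x" if "x = c * cnj y" for x y
    using that cc by (simp add: ac_simps)
  have refl_nat: "\<beta> (m - int i) = c * cnj (\<beta> (m + int i))" for i
  proof (induction i)
    case 0
    then show ?case using nz[of m] by (simp add: c_def)
  next
    case (Suc i)
    have "cnj (\<beta> (m - int i)) * \<beta> (m - int (Suc i)) = \<kappa>"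
      using \<beta>[of "m - int (Suc i)"] by (simp add: algebra_simps)
    moreover have "cnj (\<beta> (m + int (Suc i))) * \<beta> (m + int i) = \<kappa>"
      using \<beta>[of "m + int i"] by (simp add: algebra_simps)
    ultimately have "cnj (\<beta> (m - int i)) * \<beta> (m - int (Suc i))
        = cnj (\<beta> (m - int i)) * (c * cnj (\<beta> (m + int (Suc i))))"
      using swap[OF Suc] by (simp add: ac_simps)
    then show ?case using nz[of "m - int i"] by simp
  qed
  have "\<alpha> (s\<^sub>0 + m * int K - j) = c * cnj (\<alpha> (s\<^sub>0 + m * int K + j))" for j
  proof (cases "int K dvd j")
    case True
    then obtain i where i: "j = int K * i" by blast
    have "\<beta> (m - i) = c * cnj (\<beta> (m + i))"
    proof (cases "i \<ge> 0")
      case True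
      then show ?thesis using refl_nat[of "nat i"] by simp
    next
      case False
      then show ?thesis using swap[OF refl_nat[of "nat (- i)"]] by simp
    qed
    then show ?thesis by (simp add: \<beta>_def i algebra_simps)
  next
    case False
    then have "\<not> int K dvd m * int K - j" "\<not> int K dvd m * int K + j"
      by (simp_all add: dvd_diff_right_iff dvd_add_right_iff)
    then have "\<alpha> (s\<^sub>0 + m * int K - j) = 0" "\<alpha> (s\<^sub>0 + m * int K + j) = 0"
      by (intro sparse_periodic_zero[OF sp]; simp add: algebra_simps)+
    then show ?thesis by simp
  qed
  then show thesis using c that by blast
qed

lemma sparse_periodic_schur_product_const:
  assumes "sparse_periodic \<alpha> K s\<^sub>0 \<kappa>"
  shows "schur \<alpha> n * back_schur \<alpha> n = schur \<alpha> m * back_schur \<alpha> m"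
proof (rule int_shift_invariant_const[where f = "\<lambda>n. schur \<alpha> n * back_schur \<alpha> n"])
  fix s
  show "schur \<alpha> (s + 1) * back_schur \<alpha> (s + 1) = schur \<alpha> s * back_schur \<alpha> s"
  proof (cases "int K dvd s - s\<^sub>0")
    case True
    then obtain m where "s = s\<^sub>0 + m * int K" by (auto simp: dvd_def algebra_simps)
    then obtain c where "cmod c = 1" "\<And>j. \<alpha> (s - j) = c * cnj (\<alpha> (s + j))"
      using sparse_periodic_reflect[OF assms, of m] by blast
    then show ?thesis by (rule schur_product_step)
  next
    case False
    then show ?thesis
      by (intro schur_product_step_zero sparse_periodic_zero[OF assms])
  qed
qed

text \<open>The product is the same at every index, so it can be read off right after
  \<open>s\<^sub>0\<close>: the K - 1 zeros up to the next sublattice point give the order, the two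
  endpoints the coefficient \<open>- \<kappa>\<close>.\<close>

lemma sparse_periodic_entries:
  assumes \<alpha>: "\<And>n. cmod (\<alpha> n) \<le> 1" and K: "K \<ge> 1" and sp: "sparse_periodic \<alpha> K s\<^sub>0 \<kappa>"
  shows "1 \<le> l \<Longrightarrow> l < K \<Longrightarrow> entry (cmv \<alpha> ^^ l) n n = 0" and "entry (cmv \<alpha> ^^ K) n n = - \<kappa>"
proof -
  define H where "H = schur \<alpha> n * back_schur \<alpha> n"
  have "\<alpha> j = 0" if "s\<^sub>0 < j" "j < s\<^sub>0 + int K" for j
  proof -
    have "\<not> int K dvd j - s\<^sub>0" using that by (auto dest: zdvd_imp_le)
    then show ?thesis by (rule sparse_periodic_zero[OF sp])
  qed
  then have "H = fps_X ^ (K - 1) * (schur \<alpha> (s\<^sub>0 + int K) * back_schur \<alpha> (s\<^sub>0 + 1))"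
    using schur_product_between_zeros[of s\<^sub>0 "s\<^sub>0 + 1" "s\<^sub>0 + int K" \<alpha>] K
      sparse_periodic_schur_product_const[OF sp, of n "s\<^sub>0 + 1"]
    by (simp add: H_def nat_diff_distrib)
  moreover have "cnj (\<alpha> (s\<^sub>0 + (0 + 1) * int K)) * \<alpha> (s\<^sub>0 + 0 * int K) = \<kappa>"
    using sp unfolding sparse_periodic_def by blast
  then have "cnj (\<alpha> (s\<^sub>0 + int K)) * \<alpha> s\<^sub>0 = \<kappa>" by simp
  ultimately have H: "\<And>i. i < K - 1 \<Longrightarrow> fps_nth H i = 0" "fps_nth H (K - 1) = - \<kappa>"
    by (simp_all add: fps_X_power_mult_nth schur_nth_0 back_schur_nth_0)
  show "entry (cmv \<alpha> ^^ l) n n = 0" if "1 \<le> l" "l < K"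
    using entries_vanish_iff[of \<alpha> "K - 1" n] \<alpha> H(1) that by (auto simp: H_def)
  show "entry (cmv \<alpha> ^^ K) n n = - \<kappa>"
    using entry_Suc_leading[of \<alpha> "K - 1" n] \<alpha> H K by (simp add: H_def del: funpow.simps)
qed

lemma sparse_periodic_if_entries:
  assumes \<alpha>: "\<And>n. cmod (\<alpha> n) \<le> 1" and K: "K \<ge> 1" and c: "c \<noteq> 0"
    and zero: "\<And>l n. 1 \<le> l \<Longrightarrow> l < K \<Longrightarrow> entry (cmv \<alpha> ^^ l) n n = 0"
    and lead: "\<And>n. entry (cmv \<alpha> ^^ K) n n = c"
  obtains s\<^sub>0 where "sparse_periodic \<alpha> K s\<^sub>0 (- c)"
proof -
  \<comment> \<open>The product at n has order exactly K - 1 with coefficient c, so the nonzero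
    neighbours of the cut between n - 1 and n are K apart.\<close>
  have nb: "\<exists>q. q < n \<and> n \<le> q + int K \<and> \<alpha> q \<noteq> 0 \<and> (\<forall>j. q < j \<and> j < q + int K \<longrightarrow> \<alpha> j = 0)
      \<and> cnj (\<alpha> (q + int K)) * \<alpha> q = - c" for n
  proof -
    define H where "H = schur \<alpha> n * back_schur \<alpha> n"
    have H0: "fps_nth H i = 0" if "i < K - 1" for i
      using entries_vanish_iff[of \<alpha> "K - 1" n] \<alpha> zero[of _ n] that by (auto simp: H_def)
    then have H1: "fps_nth H (K - 1) = c"
      using entry_Suc_leading[of \<alpha> "K - 1" n] \<alpha> K lead[of n] by (simp add: H_def del: funpow.simps)
    then have "H \<noteq> 0" using c by auto
    then obtain p q where
      *: "q < n" "n \<le> p" "\<alpha> p \<noteq> 0" "\<alpha> q \<noteq> 0" "\<forall>j. q < j \<and> j < p \<longrightarrow> \<alpha> j = 0"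
        "\<forall>i < nat (p - q - 1). fps_nth H i = 0" "fps_nth H (nat (p - q - 1)) = - cnj (\<alpha> p) * \<alpha> q"
      unfolding H_def using schur_product_leading[of \<alpha> n] by blast
    have "nat (p - q - 1) = K - 1"
    proof (rule antisym)
      show "nat (p - q - 1) \<le> K - 1" using *(6)[rule_format, of "K - 1"] H1 c by fastforce
      have "fps_nth H (nat (p - q - 1)) \<noteq> 0" using *(3,4,7) by simp
      then show "K - 1 \<le> nat (p - q - 1)" using H0[of "nat (p - q - 1)"] by fastforce
    qed
    then have "p = q + int K" using K *(1,2) by linarith
    moreover from this *(7) H1 have "cnj (\<alpha> p) * \<alpha> q = - c"
      using \<open>nat (p - q - 1) = K - 1\<close> by simp
    ultimately show ?thesis using *(1,2,4,5) by blast
  qed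
  \<comment> \<open>A cut just above a nonzero coefficient has it as left neighbour, a cut just
    below has it as right neighbour. This carries nonvanishing by K in both directions.\<close>
  have up: "(\<forall>j. s < j \<and> j < s + int K \<longrightarrow> \<alpha> j = 0) \<and> cnj (\<alpha> (s + int K)) * \<alpha> s = - c" if "\<alpha> s \<noteq> 0" for s
  proof -
    obtain q where q: "q < s + 1" "s + 1 \<le> q + int K" "\<forall>j. q < j \<and> j < q + int K \<longrightarrow> \<alpha> j = 0"
      "cnj (\<alpha> (q + int K)) * \<alpha> q = - c" using nb[of "s + 1"] by blast
    have "q = s" using q(1,2) q(3)[rule_format, of s] that by linarith
    then show ?thesis using q by blast
  qed
  have down: "\<alpha> (s - int K) \<noteq> 0" if "\<alpha> s \<noteq> 0" for s
  proof -
    obtain q where q: "q < s" "s \<le> q + int K" "\<alpha> q \<noteq> 0" "\<forall>j. q < j \<and> j < q + int K \<longrightarrow> \<alpha> j = 0"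
      using nb[of s] by blast
    have "s = q + int K" using q(1,2) q(4)[rule_format, of s] that by linarith
    then show ?thesis using q by simp
  qed
  obtain s\<^sub>0 where s0: "\<alpha> s\<^sub>0 \<noteq> 0" using nb[of 0] by blast
  have nz: "\<alpha> (s\<^sub>0 + m * int K) \<noteq> 0" for m
  proof (induction m rule: int_induct[where k = 0])
    case (step1 m)
    then show ?case using up[OF step1(2)] c by (auto simp: algebra_simps)
  next
    case (step2 m)
    then show ?case using down[OF step2(2)] by (simp add: algebra_simps)
  qed (use s0 in simp)
  have "sparse_periodic \<alpha> K s\<^sub>0 (- c)"
    unfolding sparse_periodic_def
  proof (intro conjI allI impI)
    fix m
    show "cnj (\<alpha> (s\<^sub>0 + (m + 1) * int K)) * \<alpha> (s\<^sub>0 + m * int K) = - c"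
      using up[OF nz[of m]] by (simp add: algebra_simps)
  next
    fix j assume j: "\<not> int K dvd j"
    have "s\<^sub>0 + j = s\<^sub>0 + (j div int K) * int K + j mod int K" by simp
    moreover have "0 < j mod int K" "j mod int K < int K"
      using j K pos_mod_sign[of "int K" j] pos_mod_bound[of "int K" j]
      by (simp_all add: dvd_eq_mod_eq_0 order_less_le)
    ultimately show "\<alpha> (s\<^sub>0 + j) = 0"
      using up[OF nz[of "j div int K"], THEN conjunct1, rule_format, of "s\<^sub>0 + j"] by linarith
  qed (use c in simp)
  then show thesis using that by blast
qed

text \<open>Formal power series over a field have no zero divisors, so at each cut one half-line
  carries only zeros; two distinct nonzero coefficients would be separated by a cut.\<close>

lemma entries_vanish_all_iff:
  assumes \<alpha>: "\<And>n. cmod (\<alpha> n) \<le> 1"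
  shows "(\<forall>l\<ge>1. \<forall>n. entry (cmv \<alpha> ^^ l) n n = 0) \<longleftrightarrow> (\<exists>n\<^sub>0. \<forall>j. j \<noteq> n\<^sub>0 \<longrightarrow> \<alpha> j = 0)"
proof -
  have "(\<forall>l\<ge>1. \<forall>n. entry (cmv \<alpha> ^^ l) n n = 0) \<longleftrightarrow> (\<forall>n. schur \<alpha> n * back_schur \<alpha> n = 0)"
  proof (intro iffI allI impI)
    fix n
    assume "\<forall>l\<ge>1. \<forall>n. entry (cmv \<alpha> ^^ l) n n = 0"
    then show "schur \<alpha> n * back_schur \<alpha> n = 0"
      using entries_vanish_iff[of \<alpha> _ n, OF \<alpha>] unfolding fps_eq_iff fps_zero_nth by blast
  next
    fix l :: nat and n
    assume "\<forall>n. schur \<alpha> n * back_schur \<alpha> n = 0" "1 \<le> l"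
    then show "entry (cmv \<alpha> ^^ l) n n = 0"
      using entries_vanish_iff[of \<alpha> l n, OF \<alpha>] by (metis fps_zero_nth order_refl)
  qed
  also have "\<dots> \<longleftrightarrow> (\<forall>n. (\<forall>m\<ge>n. \<alpha> m = 0) \<or> (\<forall>m<n. \<alpha> m = 0))"
    by (simp add: schur_eq_0_iff back_schur_eq_0_iff)
  also have "\<dots> \<longleftrightarrow> (\<exists>n\<^sub>0. \<forall>j. j \<noteq> n\<^sub>0 \<longrightarrow> \<alpha> j = 0)"
  proof
    assume *: "\<forall>n. (\<forall>m\<ge>n. \<alpha> m = 0) \<or> (\<forall>m<n. \<alpha> m = 0)"
    have "j = n\<^sub>0" if "\<alpha> j \<noteq> 0" "\<alpha> n\<^sub>0 \<noteq> 0" for j n\<^sub>0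
      using *[rule_format, of j] *[rule_format, of n\<^sub>0] that by (metis linorder_neq_iff order_refl)
    then show "\<exists>n\<^sub>0. \<forall>j. j \<noteq> n\<^sub>0 \<longrightarrow> \<alpha> j = 0" by blast
  next
    assume "\<exists>n\<^sub>0. \<forall>j. j \<noteq> n\<^sub>0 \<longrightarrow> \<alpha> j = 0"
    then obtain n\<^sub>0 where "\<And>j. j \<noteq> n\<^sub>0 \<Longrightarrow> \<alpha> j = 0" by blast
    then show "\<forall>n. (\<forall>m\<ge>n. \<alpha> m = 0) \<or> (\<forall>m<n. \<alpha> m = 0)" by (metis not_less)
  qed
  finally show ?thesis .
qed

section \<open>Measures on the circle and their Fourier coefficients\<close>

inductive trig_poly :: "(real \<Rightarrow> complex) \<Rightarrow> bool" where
  trig_poly_cis: "trig_poly (\<lambda>\<theta>. c * cis (of_int l * \<theta>))"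
| trig_poly_add: "trig_poly f \<Longrightarrow> trig_poly g \<Longrightarrow> trig_poly (\<lambda>\<theta>. f \<theta> + g \<theta>)"

lemma trig_poly_mult:
  assumes "trig_poly f" and "trig_poly g"
  shows "trig_poly (\<lambda>\<theta>. f \<theta> * g \<theta>)"
  using assms(1)
proof induction
  case (trig_poly_cis c l)
  show ?case
    using assms(2)
  proof induction
    case (trig_poly_cis d m)
    have "(\<lambda>\<theta>. c * cis (of_int l * \<theta>) * (d * cis (of_int m * \<theta>))) = (\<lambda>\<theta>. c * d * cis (of_int (l + m) * \<theta>))"
    proof
      fix \<theta>
      have "cis (of_int (l + m) * \<theta>) = cis (of_int l * \<theta>) * cis (of_int m * \<theta>)"
        by (simp add: cis_mult distrib_right)
      then show "c * cis (of_int l * \<theta>) * (d * cis (of_int m * \<theta>)) = c * d * cis (of_int (l + m) * \<theta>)"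
        by (simp only: ac_simps)
    qed
    then show ?case by (simp only: trig_poly.trig_poly_cis)
  next
    case (trig_poly_add f g)
    then show ?case by (simp only: distrib_left trig_poly.trig_poly_add)
  qed
next
  case (trig_poly_add f1 f2)
  then show ?case by (simp only: distrib_right trig_poly.trig_poly_add)
qed

lemma trig_poly_const: "trig_poly (\<lambda>_. c)"
  using trig_poly_cis[of c 0] by simp

text \<open>By Euler's formula a real linear form of \<open>cis \<theta>\<close> uses only the
  frequencies 1 and -1; sums and products stay inside the class.\<close>

lemma trig_poly_real_polynomial_function:
  assumes "real_polynomial_function f"
  shows "trig_poly (\<lambda>\<theta>. complex_of_real (f (cis \<theta>)))"
  using assms
proof induction
  case (linear f)
  interpret bounded_linear f by fact
  define a b where "a = complex_of_real (f 1)" and "b = complex_of_real (f \<i>)"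
  have "complex_of_real (f (cis \<theta>)) = (a - \<i> * b) / 2 * cis (of_int 1 * \<theta>) + (a + \<i> * b) / 2 * cis (of_int (- 1) * \<theta>)" for \<theta>
  proof -
    have "cis \<theta> = cos \<theta> *\<^sub>R 1 + sin \<theta> *\<^sub>R \<i>" by (simp add: complex_eq_iff)
    then have "f (cis \<theta>) = cos \<theta> * f 1 + sin \<theta> * f \<i>" by (simp only: add scale real_scaleR_def)
    then show ?thesis by (simp add: complex_eq_iff a_def b_def field_simps)
  qed
  then show ?case by (simp only: trig_poly.intros)
next
  case (const c)
  show ?case by (rule trig_poly_const)
next
  case (add f g)
  then show ?case by (simp only: of_real_add trig_poly_add)
next
  case (mult f g)
  then show ?case by (simp only: of_real_mult trig_poly_mult)
qed

section \<open>Passing between the circle and its angles\<close>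

lemma borel_measurable_cis [measurable]: "cis \<in> borel_measurable borel"
  by (intro borel_measurable_continuous_onI continuous_intros)

text \<open>\<open>Arg2pi\<close> is continuous off the nonnegative real ray and equal to 0 on
  it.\<close>

lemma borel_measurable_Arg2pi [measurable]: "Arg2pi \<in> borel_measurable borel"
proof -
  have "(\<lambda>z. if z \<in> \<real>\<^sub>\<ge>\<^sub>0 then 0 else Arg2pi z) \<in> borel_measurable borel"
    by (intro borel_measurable_continuous_on_if continuous_at_imp_continuous_on)
      (auto intro: continuous_at_Arg2pi)
  moreover have "(\<lambda>z. if z \<in> \<real>\<^sub>\<ge>\<^sub>0 then 0 else Arg2pi z) = Arg2pi"
    by (auto simp: fun_eq_iff Arg2pi_eq_0 nonneg_Reals_def complex_is_Real_iff)
  ultimately show ?thesis by simp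
qed

lemma Arg2pi_cis: "\<theta> \<in> {0..<2 * pi} \<Longrightarrow> Arg2pi (cis \<theta>) = \<theta>"
  by (rule Arg2pi_unique[of 1]) (auto simp: cis_conv_exp)

lemma cis_Arg2pi: "cmod z = 1 \<Longrightarrow> cis (Arg2pi z) = z"
  using Arg2pi_eq[of z] by (simp add: cis_conv_exp)

abbreviation circle :: "real measure" where
  "circle \<equiv> restrict_space borel {0..<2 * pi}"

text \<open>These continuous bounded functions carry equality of integrals over to closed sets,
  which generate the Borel sets.\<close>

lemma closed_indicator_limit:
  fixes C :: "'a::metric_space set"
  assumes "closed C" "C \<noteq> {}"
  shows "(\<lambda>n. max 0 (1 - real n * infdist x C)) \<longlonglongrightarrow> indicator C x"
proof (cases "x \<in> C")
  case True
  then show ?thesis by simp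
next
  case False
  then have pos: "infdist x C > 0" using assms by (intro infdist_pos_not_in_closed)
  obtain N :: nat where N: "1 / infdist x C < real N" using reals_Archimedean2 by blast
  have "max 0 (1 - real n * infdist x C) = 0" if "n \<ge> N" for n
  proof -
    have "1 / infdist x C < real n" using N that by linarith
    then show ?thesis using pos by (simp add: field_simps)
  qed
  then have "eventually (\<lambda>n. max 0 (1 - real n * infdist x C) = 0) sequentially"
    by (auto simp: eventually_sequentially)
  then show ?thesis using False by (simp add: tendsto_eventually)
qed

text \<open>Trigonometric polynomials are the restrictions of polynomials to the unit circle, so
  Stone-Weierstrass applies after transporting the measures to the plane by \<open>cis\<close>.\<close>

lemma circle_measure_unique:
  fixes \<mu> \<nu> :: "real measure"
  assumes \<mu>: "prob_space \<mu>" "sets \<mu> = sets circle" and \<nu>: "prob_space \<nu>" "sets \<nu> = sets circle"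
    and eq: "\<And>l::int. (\<integral>\<theta>. cis (of_int l * \<theta>) \<partial>\<mu>) = (\<integral>\<theta>. cis (of_int l * \<theta>) \<partial>\<nu>)"
  shows "\<mu> = \<nu>"
proof -
  interpret m: prob_space \<mu> by fact
  interpret n: prob_space \<nu> by fact
  have meas: "f \<in> borel_measurable \<mu>" "f \<in> borel_measurable \<nu>" if "f \<in> borel_measurable borel"
    for f :: "real \<Rightarrow> 'b::topological_space"
    using that \<mu>(2) \<nu>(2) measurable_restrict_space1[OF that]
    by (auto cong: measurable_cong_sets)
  have trig: "integrable \<mu> f \<and> integrable \<nu> f \<and> integral\<^sup>L \<mu> f = integral\<^sup>L \<nu> f" if "trig_poly f" for f
    using that
  proof induction
    case (trig_poly_cis c l)
    have "(\<lambda>\<theta>. cis (of_int l * \<theta>)) \<in> borel_measurable borel" by measurable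
    note this[THEN meas(1)] this[THEN meas(2)]
    then have "integrable \<mu> (\<lambda>\<theta>. cis (of_int l * \<theta>))" "integrable \<nu> (\<lambda>\<theta>. cis (of_int l * \<theta>))"
      by (auto intro!: m.integrable_const_bound[where B = 1] n.integrable_const_bound[where B = 1])
    then show ?case using eq by simp
  next
    case (trig_poly_add f g)
    then show ?case by simp
  qed
  have cont: "integral\<^sup>L \<mu> (\<lambda>\<theta>. f (cis \<theta>)) = integral\<^sup>L \<nu> (\<lambda>\<theta>. f (cis \<theta>))"
    if f: "continuous_on UNIV f" for f :: "complex \<Rightarrow> real"
  proof -
    have fcis: "continuous_on UNIV (\<lambda>\<theta>. f (cis \<theta>))"
      using f by (rule continuous_on_compose2) (auto intro!: continuous_intros)
    have "compact (f ` sphere 0 1)"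
      using f by (intro compact_continuous_image continuous_on_subset[OF f]) auto
    then obtain B where B: "\<forall>z\<in>sphere 0 1. \<bar>f z\<bar> \<le> B"
      by (auto dest!: compact_imp_bounded simp: bounded_iff)
    have int: "integrable \<mu> (\<lambda>\<theta>. f (cis \<theta>))" "integrable \<nu> (\<lambda>\<theta>. f (cis \<theta>))"
      using meas[OF borel_measurable_continuous_onI[OF fcis]] B
      by (auto intro!: m.integrable_const_bound[where B = B] n.integrable_const_bound[where B = B])
    have "\<bar>integral\<^sup>L \<mu> (\<lambda>\<theta>. f (cis \<theta>)) - integral\<^sup>L \<nu> (\<lambda>\<theta>. f (cis \<theta>))\<bar> \<le> 0 + e" if "e > 0" for e
    proof -
      from that have "e / 2 > 0" by simp
      then obtain g where g: "real_polynomial_function g" "\<And>z. z \<in> sphere 0 1 \<Longrightarrow> \<bar>f z - g z\<bar> < e / 2"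
        using Stone_Weierstrass_real_polynomial_function[of "sphere 0 1" f "e / 2"] continuous_on_subset[OF f]
        by (metis compact_sphere subset_UNIV)
      have tp: "trig_poly (\<lambda>\<theta>. complex_of_real (g (cis \<theta>)))"
        using g(1) by (rule trig_poly_real_polynomial_function)
      then have gi: "integrable \<mu> (\<lambda>\<theta>. g (cis \<theta>))" "integrable \<nu> (\<lambda>\<theta>. g (cis \<theta>))"
        using trig[OF tp] by (simp_all add: complex_of_real_integrable_eq)
      have "integral\<^sup>L \<mu> (\<lambda>\<theta>. g (cis \<theta>)) = integral\<^sup>L \<nu> (\<lambda>\<theta>. g (cis \<theta>))"
        using trig[OF tp] by simp
      moreover have "\<bar>integral\<^sup>L \<mu> (\<lambda>\<theta>. f (cis \<theta>)) - integral\<^sup>L \<mu> (\<lambda>\<theta>. g (cis \<theta>))\<bar> \<le> e / 2"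
      proof -
        have "\<bar>\<integral>\<theta>. f (cis \<theta>) - g (cis \<theta>) \<partial>\<mu>\<bar> \<le> (\<integral>\<theta>. \<bar>f (cis \<theta>) - g (cis \<theta>)\<bar> \<partial>\<mu>)"
          by (rule integral_abs_bound)
        also have "\<dots> \<le> (\<integral>\<theta>. e / 2 \<partial>\<mu>)"
          using int gi g(2)[of "cis _"] by (intro integral_mono) (auto intro: less_imp_le)
        finally show ?thesis using int gi by (simp add: m.prob_space)
      qed
      moreover have "\<bar>integral\<^sup>L \<nu> (\<lambda>\<theta>. f (cis \<theta>)) - integral\<^sup>L \<nu> (\<lambda>\<theta>. g (cis \<theta>))\<bar> \<le> e / 2"
      proof -
        have "\<bar>\<integral>\<theta>. f (cis \<theta>) - g (cis \<theta>) \<partial>\<nu>\<bar> \<le> (\<integral>\<theta>. \<bar>f (cis \<theta>) - g (cis \<theta>)\<bar> \<partial>\<nu>)"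
          by (rule integral_abs_bound)
        also have "\<dots> \<le> (\<integral>\<theta>. e / 2 \<partial>\<nu>)"
          using int gi g(2)[of "cis _"] by (intro integral_mono) (auto intro: less_imp_le)
        finally show ?thesis using int gi by (simp add: n.prob_space)
      qed
      ultimately show ?thesis by linarith
    qed
    then have "\<bar>integral\<^sup>L \<mu> (\<lambda>\<theta>. f (cis \<theta>)) - integral\<^sup>L \<nu> (\<lambda>\<theta>. f (cis \<theta>))\<bar> \<le> 0"
      by (rule field_le_epsilon)
    then show ?thesis by simp
  qed
  have cis_m: "cis \<in> borel_measurable \<mu>" "cis \<in> borel_measurable \<nu>"
    using meas[OF borel_measurable_cis] .
  have closed: "emeasure (distr \<mu> borel cis) C = emeasure (distr \<nu> borel cis) C" if C: "closed C" for C
  proof (cases "C = {}")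
    case False
    have lim: "(\<lambda>n. \<integral>\<theta>. max 0 (1 - real n * infdist (cis \<theta>) C) \<partial>M) \<longlonglongrightarrow> measure (distr M borel cis) C"
      if M: "prob_space M" "cis \<in> borel_measurable M" for M
    proof -
      interpret prob_space M by fact
      note M(2)[measurable]
      have Cb: "C \<in> sets borel" using C by simp
      have [measurable]: "(\<lambda>z. infdist z C) \<in> borel_measurable borel"
        by (intro borel_measurable_continuous_onI continuous_intros)
      have "(\<lambda>n. \<integral>\<theta>. max 0 (1 - real n * infdist (cis \<theta>) C) \<partial>M) \<longlonglongrightarrow> (\<integral>\<theta>. indicator C (cis \<theta>) \<partial>M)"
      proof (rule integral_dominated_convergence[where w = "\<lambda>_. 1"])
        show "(\<lambda>\<theta>. indicator C (cis \<theta>) :: real) \<in> borel_measurable M" using Cb by measurable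
        show "AE x in M. (\<lambda>n. max 0 (1 - real n * infdist (cis x) C)) \<longlonglongrightarrow> indicator C (cis x)"
          using closed_indicator_limit[OF C False] by simp
        show "AE x in M. norm (max 0 (1 - real n * infdist (cis x) C)) \<le> 1" for n
          by (simp add: infdist_nonneg)
      qed simp_all
      also have "(\<integral>\<theta>. indicator C (cis \<theta>) \<partial>M :: real) = (\<integral>z. indicator C z \<partial>distr M borel cis)"
        using Cb M(2) by (intro integral_distr[symmetric, of cis M borel]) auto
      also have "\<dots> = measure (distr M borel cis) C" using Cb by simp
      finally show ?thesis .
    qed
    have "continuous_on UNIV (\<lambda>z. max 0 (1 - real n * infdist z C))" for n
      by (intro continuous_intros)
    from cont[OF this]
    have "(\<lambda>n. \<integral>\<theta>. max 0 (1 - real n * infdist (cis \<theta>) C) \<partial>\<mu>)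
        = (\<lambda>n. \<integral>\<theta>. max 0 (1 - real n * infdist (cis \<theta>) C) \<partial>\<nu>)"
      by (rule ext)
    with lim[OF \<mu>(1) cis_m(1)] have "measure (distr \<mu> borel cis) C = measure (distr \<nu> borel cis) C"
      by (intro LIMSEQ_unique[OF _ lim[OF \<nu>(1) cis_m(2)]]) simp
    then show ?thesis
      using m.prob_space_distr[OF cis_m(1)] n.prob_space_distr[OF cis_m(2)]
      by (simp add: finite_measure.emeasure_eq_measure prob_space.finite_measure)
  qed simp
  have "distr \<mu> borel cis = distr \<nu> borel cis"
  proof (rule measure_eqI_generator_eq[where E = "Collect closed" and \<Omega> = UNIV and A = "\<lambda>_. UNIV"])
    show "Int_stable (Collect closed :: complex set set)" by (auto simp: Int_stable_def)
    show "sets (distr \<mu> borel cis) = sigma_sets UNIV (Collect closed)"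
      "sets (distr \<nu> borel cis) = sigma_sets UNIV (Collect closed)"
      by (simp_all add: borel_eq_closed)
    interpret d: prob_space "distr \<mu> borel cis" using m.prob_space_distr[OF cis_m(1)] .
    show "emeasure (distr \<mu> borel cis) UNIV \<noteq> \<infinity>" using d.emeasure_finite by simp
  qed (use closed in auto)
  \<comment> \<open>\<open>Arg2pi\<close> inverts \<open>cis\<close> on \<open>{0..<2 * pi}\<close>,
    so the measure is recovered from its image in the plane.\<close>
  moreover have "distr (distr M borel cis) circle Arg2pi = M" if M: "prob_space M" "sets M = sets circle" for M
  proof -
    have space: "space M = {0..<2 * pi}" using sets_eq_imp_space_eq[OF M(2)] by (simp add: space_restrict_space)
    have c: "cis \<in> borel_measurable M"
      using measurable_restrict_space1[OF borel_measurable_cis] M(2) by (simp cong: measurable_cong_sets)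
    have A: "Arg2pi \<in> measurable borel circle"
      by (rule measurable_restrict_space2) (auto simp: Arg2pi_ge_0 Arg2pi_lt_2pi)
    have "distr (distr M borel cis) circle Arg2pi = distr M circle (Arg2pi \<circ> cis)"
      using A c by (rule distr_distr)
    also have "\<dots> = distr M circle (\<lambda>x. x)"
      by (rule distr_cong) (auto simp: space Arg2pi_cis)
    also have "\<dots> = M" using M(2) by (intro distr_id2) simp
    finally show ?thesis .
  qed
  ultimately show ?thesis using \<mu> \<nu> by metis
qed

section \<open>Herglotz' theorem: existence of the measure\<close>

lemma has_bochner_integral_cis_0_2pi:
  "has_bochner_integral lborel (\<lambda>\<theta>. indicator {0..2 * pi} \<theta> *\<^sub>R cis (of_int m * \<theta>))
     (if m = 0 then of_real (2 * pi) else 0)"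
proof (cases "m = 0")
  case True
  have "has_bochner_integral lborel (\<lambda>\<theta>. indicator {0..2 * pi} \<theta> *\<^sub>R (1 :: complex))
      (measure lborel {0..2 * pi} *\<^sub>R 1)"
    by (intro has_bochner_integral_scaleR_left has_bochner_integral_real_indicator) simp_all
  then show ?thesis using True by (simp add: scaleR_conv_of_real)
next
  case False
  define F where "F = (\<lambda>\<theta>. cis (of_int m * \<theta>) / (\<i> * of_int m))"
  have "has_bochner_integral lborel (\<lambda>\<theta>. indicator {0..2 * pi} \<theta> *\<^sub>R cis (of_int m * \<theta>)) (F (2 * pi) - F 0)"
  proof (rule has_bochner_integral_FTC_Icc)
    show "(F has_vector_derivative cis (of_int m * \<theta>)) (at \<theta> within {0..2 * pi})" for \<theta>
      unfolding F_def cis_conv_exp using False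
      by (auto intro!: derivative_eq_intros has_vector_derivative_real_field simp: mult.commute[of "exp _" \<i>])
    show "continuous_on {0..2 * pi} (\<lambda>\<theta>. cis (of_int m * \<theta>))" by (intro continuous_intros)
  qed simp
  moreover have "F (2 * pi) = F 0"
    using cis_multiple_2pi[of "of_int m"] by (simp add: F_def mult.commute)
  ultimately show ?thesis using False by simp
qed

text \<open>This is the Fejer weight: divided by N it is max(0, 1 - l/N), the maximum coming from
  truncated subtraction.\<close>

lemma count_differences:
  "(\<Sum>j<N. \<Sum>k<N. if int j - int k = int l then 1 else 0 :: nat) = N - l"
proof -
  have "(\<Sum>j<N. \<Sum>k<N. if int j - int k = int l then 1 else 0 :: nat)
      = (\<Sum>k<N. \<Sum>j<N. if j = k + l then 1 else 0)"
    by (subst sum.swap) (intro sum.cong refl if_cong, auto)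
  also have "\<dots> = (\<Sum>k<N. if k < N - l then 1 else 0)"
    by (intro sum.cong refl) (auto simp: less_diff_conv)
  also have "\<dots> = card ({..<N} \<inter> {k. k < N - l})"
    by (simp add: sum.If_cases)
  also have "{..<N} \<inter> {k. k < N - l} = {..<N - l}" by auto
  finally show ?thesis by simp
qed

text \<open>The Fejer means of the sequence are probability densities \<open>D N\<close> on the circle; a weak limit
  point has the right moments.  It lives on the real line and is wrapped around the circle.\<close>

lemma herglotz:
  fixes c :: "int \<Rightarrow> complex"
  assumes c_0: "c 0 = 1" and herm: "\<And>l. c (- l) = cnj (c l)"
    and pos: "\<And>N a. 0 \<le> Re (\<Sum>j<N. \<Sum>k<N. cnj (a k) * a j * c (int j - int k))"
  shows "\<exists>\<mu>. prob_space \<mu> \<and> sets \<mu> = sets circle \<and> (\<forall>l::int. (\<integral>\<theta>. cis (of_int l * \<theta>) \<partial>\<mu>) = c l)"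
proof -
  define F where "F N \<theta> = (\<Sum>j<N. \<Sum>k<N. cis (of_int (int k - int j) * \<theta>) * c (int j - int k))" for N \<theta>
  \<comment> \<open>In this form \<open>F\<close> is the Toeplitz form of \<open>c\<close> at the
    vector with entries \<open>cis (- real j * \<theta>)\<close>, so \<open>pos\<close>
    applies.\<close>
  have F_eq: "F N \<theta> = (\<Sum>j<N. \<Sum>k<N. cnj (cis (- real k * \<theta>)) * cis (- real j * \<theta>) * c (int j - int k))" for N \<theta>
    unfolding F_def by (intro sum.cong refl) (simp add: cis_cnj cis_mult algebra_simps)
  have F_pos: "0 \<le> Re (F N \<theta>)" for N \<theta>
    unfolding F_eq by (rule pos)
  have "cnj (F N \<theta>) = F N \<theta>" for N \<theta>
  proof -
    have "cnj (F N \<theta>) = (\<Sum>j<N. \<Sum>k<N. cis (of_int (int j - int k) * \<theta>) * c (int k - int j))"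
      unfolding F_def cnj_sum
      by (intro sum.cong refl) (simp add: cis_cnj minus_mult_left flip: herm)
    also have "\<dots> = F N \<theta>" unfolding F_def by (rule sum.swap)
    finally show ?thesis .
  qed
  then have F_real: "of_real (Re (F N \<theta>)) = F N \<theta>" for N \<theta>
    by (simp add: complex_eq_iff)
  \<comment> \<open>Frequency 0 occurs \<open>Suc N\<close> times in \<open>F (Suc N)\<close>, each
    time with coefficient \<open>c 0 = 1\<close>; the denominator normalises the total mass to
    1.\<close>
  define D where "D N \<theta> = indicator {0..2 * pi} \<theta> * Re (F (Suc N) \<theta>) / (2 * pi * real (Suc N))" for N \<theta>
  have D_pos: "0 \<le> D N \<theta>" for N \<theta> unfolding D_def by (simp add: F_pos)
  have F_meas: "F N \<in> borel_measurable borel" for N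
    unfolding F_def by measurable
  have [measurable]: "D N \<in> borel_measurable borel" for N
    unfolding D_def using F_meas by measurable
  have D_int: "has_bochner_integral lborel (\<lambda>\<theta>. D N \<theta> *\<^sub>R cis (real l * \<theta>))
      (of_real (real (Suc N - l) / real (Suc N)) * c (int l))" for N l
  proof -
    have "has_bochner_integral lborel
        (\<lambda>\<theta>. (\<Sum>j<Suc N. \<Sum>k<Suc N. (indicator {0..2 * pi} \<theta> *\<^sub>R cis (of_int (int l + int k - int j) * \<theta>)) * c (int j - int k))
          / of_real (2 * pi * real (Suc N)))
        ((\<Sum>j<Suc N. \<Sum>k<Suc N. (if int l + int k - int j = 0 then of_real (2 * pi) else 0) * c (int j - int k))
          / of_real (2 * pi * real (Suc N)))"
      by (intro has_bochner_integral_divide has_bochner_integral_sum has_bochner_integral_mult_left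
          has_bochner_integral_cis_0_2pi)
    moreover have "D N \<theta> *\<^sub>R cis (real l * \<theta>)
      = (\<Sum>j<Suc N. \<Sum>k<Suc N. (indicator {0..2 * pi} \<theta> *\<^sub>R cis (of_int (int l + int k - int j) * \<theta>)) * c (int j - int k))
          / of_real (2 * pi * real (Suc N))" for \<theta>
    proof -
      have "D N \<theta> *\<^sub>R cis (real l * \<theta>)
          = indicator {0..2 * pi} \<theta> *\<^sub>R (cis (real l * \<theta>) * F (Suc N) \<theta>) / of_real (2 * pi * real (Suc N))"
        unfolding D_def by (subst F_real[symmetric]) (simp add: scaleR_conv_of_real)
      also have "indicator {0..2 * pi} \<theta> *\<^sub>R (cis (real l * \<theta>) * F (Suc N) \<theta>)
        = (\<Sum>j<Suc N. \<Sum>k<Suc N. (indicator {0..2 * pi} \<theta> *\<^sub>R cis (of_int (int l + int k - int j) * \<theta>)) * c (int j - int k))"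
      proof -
        have "cis (of_int (int l + int k - int j) * \<theta>) = cis (real l * \<theta>) * cis (of_int (int k - int j) * \<theta>)" for j k
          by (simp add: cis_mult algebra_simps)
        then show ?thesis
          unfolding F_def by (simp only: sum_distrib_left scaleR_sum_right mult.assoc mult_scaleR_left)
      qed
      finally show ?thesis .
    qed
    moreover have "(\<Sum>j<Suc N. \<Sum>k<Suc N. (if int l + int k - int j = 0 then of_real (2 * pi) else 0) * c (int j - int k))
          / of_real (2 * pi * real (Suc N)) = of_real (real (Suc N - l) / real (Suc N)) * c (int l)"
    proof -
      have "(\<Sum>j<Suc N. \<Sum>k<Suc N. (if int l + int k - int j = 0 then of_real (2 * pi) else 0) * c (int j - int k))
          = (\<Sum>j<Suc N. \<Sum>k<Suc N. of_nat (if int j - int k = int l then 1 else 0) * (of_real (2 * pi) * c (int l)))"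
      proof (intro sum.cong refl)
        fix j k
        have "int l + int k - int j = 0 \<longleftrightarrow> int j - int k = int l" by linarith
        then show "(if int l + int k - int j = 0 then of_real (2 * pi) else 0) * c (int j - int k)
            = of_nat (if int j - int k = int l then 1 else 0) * (of_real (2 * pi) * c (int l))"
          by (cases "int j - int k = int l") simp_all
      qed
      also have "\<dots> = of_nat (\<Sum>j<Suc N. \<Sum>k<Suc N. if int j - int k = int l then 1 else 0) * (of_real (2 * pi) * c (int l))"
        by (simp only: sum_distrib_right of_nat_sum)
      also have "\<dots> = of_nat (Suc N - l) * (of_real (2 * pi) * c (int l))"
        by (simp only: count_differences)
      finally show ?thesis by (simp add: field_simps del: of_nat_Suc of_nat_diff)
    qed
    ultimately show ?thesis by simp
  qed
  define M where "M N = density lborel (\<lambda>\<theta>. ennreal (D N \<theta>))" for N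
  have M_int: "(\<integral>\<theta>. cis (real l * \<theta>) \<partial>M N) = of_real (real (Suc N - l) / real (Suc N)) * c (int l)" for N l
  proof -
    have "(\<integral>\<theta>. cis (real l * \<theta>) \<partial>M N) = (\<integral>\<theta>. D N \<theta> *\<^sub>R cis (real l * \<theta>) \<partial>lborel)"
      unfolding M_def by (rule integral_density) (simp_all add: D_pos)
    also have "\<dots> = of_real (real (Suc N - l) / real (Suc N)) * c (int l)"
      by (rule has_bochner_integral_integral_eq[OF D_int])
    finally show ?thesis .
  qed
  have D_total: "has_bochner_integral lborel (D N) 1" for N
  proof -
    have "has_bochner_integral lborel (\<lambda>\<theta>. complex_of_real (D N \<theta>)) 1"
      using D_int[of N 0] by (simp add: c_0 scaleR_conv_of_real)
    from has_bochner_integral_bounded_linear[OF bounded_linear_Re this] show ?thesis by simp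
  qed
  have M_distr: "real_distribution (M N)" for N
  proof -
    have "emeasure (M N) (space (M N)) = (\<integral>\<^sup>+\<theta>. ennreal (D N \<theta>) \<partial>lborel)"
      unfolding M_def by (subst emeasure_density) simp_all
    also have "\<dots> = ennreal (integral\<^sup>L lborel (D N))"
      using D_total[of N] D_pos by (intro nn_integral_eq_integral) (auto simp: has_bochner_integral_iff)
    also have "\<dots> = 1" using D_total[of N] by (simp add: has_bochner_integral_iff)
    finally have "prob_space (M N)" by (rule prob_spaceI)
    then show ?thesis by (simp add: real_distribution_def real_distribution_axioms_def M_def)
  qed
  have "tight M"
    unfolding tight_def
  proof (intro conjI allI impI)
    fix \<epsilon> :: real assume "\<epsilon> > 0"
    show "\<exists>a b. a < b \<and> (\<forall>N. 1 - \<epsilon> < measure (M N) {a<..b})"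
    proof (rule exI[of _ "-1"], rule exI[of _ "2 * pi"], intro conjI allI)
      fix N
      interpret real_distribution "M N" by (rule M_distr)
      have "emeasure (M N) (- {-1<..2 * pi}) = (\<integral>\<^sup>+\<theta>. ennreal (D N \<theta>) * indicator (- {-1<..2 * pi}) \<theta> \<partial>lborel)"
        unfolding M_def by (subst emeasure_density) simp_all
      also have "\<dots> = (\<integral>\<^sup>+(\<theta>::real). 0 \<partial>lborel)"
        by (intro nn_integral_cong) (auto simp: D_def indicator_def)
      finally have "prob (- {-1<..2 * pi}) = 0" by (simp add: measure_def)
      then have "prob {-1<..2 * pi} = 1"
        using prob_compl[of "{-1<..2 * pi}"] by (simp add: M_def Compl_eq_Diff_UNIV)
      then show "1 - \<epsilon> < prob {-1<..2 * pi}" using \<open>\<epsilon> > 0\<close> by simp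
    qed (use pi_gt_zero in linarith)
  qed (rule M_distr)
  from tight_imp_convergent_subsubsequence[OF this, of id] obtain r \<nu> where
    r: "strict_mono r" and \<nu>: "real_distribution \<nu>" and conv: "weak_conv_m (M \<circ> r) \<nu>"
    by (auto simp: strict_mono_def)
  \<comment> \<open>Moments are values of the characteristic function at integers, so Levy
    continuity passes them to the weak limit.\<close>
  have char: "char \<eta> t = (\<integral>\<theta>. cis (t * \<theta>) \<partial>\<eta>)" for \<eta> t
    by (simp add: char_def cis_conv_exp)
  have \<nu>_nat: "(\<integral>\<theta>. cis (real l * \<theta>) \<partial>\<nu>) = c (int l)" for l
  proof -
    have "(\<lambda>N. of_real (real (Suc N - l) / real (Suc N)) * c (int l)) \<longlonglongrightarrow> of_real 1 * c (int l)"
    proof (intro tendsto_intros)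
      have "(\<lambda>N. 1 - real l / real (Suc N)) \<longlonglongrightarrow> 1 - 0"
        by (intro tendsto_intros LIMSEQ_Suc[OF lim_const_over_n])
      moreover have "eventually (\<lambda>N. 1 - real l / real (Suc N) = real (Suc N - l) / real (Suc N)) sequentially"
        using eventually_ge_at_top[of l] by eventually_elim (simp add: of_nat_diff field_simps)
      ultimately show "(\<lambda>N. real (Suc N - l) / real (Suc N)) \<longlonglongrightarrow> 1"
        by (simp add: tendsto_cong)
    qed
    then have "(\<lambda>N. char (M N) (real l)) \<longlonglongrightarrow> c (int l)"
      by (simp only: char M_int of_real_1 mult_1_left)
    then have "(\<lambda>N. char ((M \<circ> r) N) (real l)) \<longlonglongrightarrow> c (int l)"
      using LIMSEQ_subseq_LIMSEQ[OF _ r] by (simp add: o_def)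
    moreover have "(\<lambda>N. char ((M \<circ> r) N) (real l)) \<longlonglongrightarrow> char \<nu> (real l)"
      by (rule levy_continuity1[OF _ \<nu> conv]) (simp add: M_distr)
    ultimately have "char \<nu> (real l) = c (int l)" by (rule LIMSEQ_unique[rotated])
    then show ?thesis by (simp only: char)
  qed
  have \<nu>_int: "(\<integral>\<theta>. cis (of_int l * \<theta>) \<partial>\<nu>) = c l" for l
  proof (cases "l \<ge> 0")
    case True
    then show ?thesis using \<nu>_nat[of "nat l"] by simp
  next
    case False
    then have "(\<integral>\<theta>. cis (of_int l * \<theta>) \<partial>\<nu>) = (\<integral>\<theta>. cnj (cis (real (nat (- l)) * \<theta>)) \<partial>\<nu>)"
      by (simp add: cis_cnj)
    also have "\<dots> = c l"
      using False by (simp only: Bochner_Integration.integral_cnj \<nu>_nat flip: herm) simp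
    finally show ?thesis .
  qed
  interpret \<nu>: real_distribution \<nu> by (rule \<nu>)
  \<comment> \<open>Integer frequencies do not notice reduction of angles modulo 2 pi, so the
    moments survive the wrapping.\<close>
  define \<mu> where "\<mu> = distr \<nu> circle (\<lambda>\<theta>. Arg2pi (cis \<theta>))"
  have wrap: "(\<lambda>\<theta>. Arg2pi (cis \<theta>)) \<in> measurable \<nu> circle"
    by (rule measurable_restrict_space2) (auto simp: Arg2pi_ge_0 Arg2pi_lt_2pi)
  have "prob_space \<mu>" unfolding \<mu>_def by (rule \<nu>.prob_space_distr[OF wrap])
  moreover have "(\<integral>\<theta>. cis (of_int l * \<theta>) \<partial>\<mu>) = c l" for l :: int
  proof -
    have "(\<integral>\<theta>. cis (of_int l * \<theta>) \<partial>\<mu>) = (\<integral>\<theta>. cis (of_int l * Arg2pi (cis \<theta>)) \<partial>\<nu>)"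
      unfolding \<mu>_def by (intro integral_distr[OF wrap] measurable_restrict_space1) measurable
    also have "\<dots> = (\<integral>\<theta>. cis (of_int l * \<theta>) \<partial>\<nu>)"
      by (simp add: cis_Arg2pi flip: cis_power_int)
    finally show ?thesis using \<nu>_int by simp
  qed
  ultimately show ?thesis by (intro exI[of _ \<mu>]) (simp add: \<mu>_def)
qed

section \<open>Spectral measures of unitary operators\<close>

lemma delta_in_ell2: "delta n \<in> ell2"
proof -
  have "((\<lambda>m. (cmod (delta n m))\<^sup>2) summable_on UNIV) \<longleftrightarrow> ((\<lambda>m. (cmod (delta n m))\<^sup>2) summable_on {n})"
    by (rule summable_on_cong_neutral) (auto simp: delta_def)
  then show ?thesis by (simp add: ell2_def)
qed

lemma ell2_inner_commute: "ell2_inner y x = cnj (ell2_inner x y)"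
  unfolding ell2_inner_def by (simp add: mult.commute flip: infsum_cnj)

lemma ell2_inner_has_sum:
  assumes "x \<in> ell2" and "y \<in> ell2"
  shows "((\<lambda>n. cnj (x n) * y n) has_sum ell2_inner x y) UNIV"
  unfolding ell2_inner_def using ell2_inner_summable[of even x y] assms by simp

lemma has_sum_sum:
  fixes f :: "'i \<Rightarrow> 'a \<Rightarrow> 'b::topological_comm_monoid_add"
  assumes "\<And>i. i \<in> I \<Longrightarrow> (f i has_sum S i) A"
  shows "((\<lambda>x. \<Sum>i\<in>I. f i x) has_sum (\<Sum>i\<in>I. S i)) A"
  using assms by (induction I rule: infinite_finite_induct) (auto intro: has_sum_add)

text \<open>At each coordinate m the double sum is the squared modulus of
  \<open>\<Sum>j<N. a j * x j m\<close>.\<close>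

lemma ell2_inner_gram_nonneg:
  fixes x :: "nat \<Rightarrow> int \<Rightarrow> complex"
  assumes "\<And>j. x j \<in> ell2"
  shows "0 \<le> Re (\<Sum>j<N. \<Sum>k<N. cnj (a k) * a j * ell2_inner (x k) (x j))"
proof -
  have "((\<lambda>m. \<Sum>j<N. \<Sum>k<N. cnj (a k) * a j * (cnj (x k m) * x j m))
      has_sum (\<Sum>j<N. \<Sum>k<N. cnj (a k) * a j * ell2_inner (x k) (x j))) UNIV"
    by (intro has_sum_sum has_sum_cmult_right ell2_inner_has_sum assms)
  from has_sum_Re[OF this] show ?thesis
  proof (rule has_sum_nonneg)
    fix m
    define w where "w = (\<Sum>j<N. a j * x j m)"
    have "(\<Sum>j<N. \<Sum>k<N. cnj (a k) * a j * (cnj (x k m) * x j m)) = w * cnj w"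
      unfolding w_def cnj_sum sum_product by (intro sum.cong refl) (simp add: ac_simps)
    then show "0 \<le> Re (\<Sum>j<N. \<Sum>k<N. cnj (a k) * a j * (cnj (x k m) * x j m))"
      by (simp add: complex_mult_cnj)
  qed
qed

text \<open>\<open>int_power\<close> uses the inverse on arbitrary sequences, hence the assumption \<open>bij\<close> besides
  unitarity on \<open>ell2\<close>.\<close>

locale bijective_unitary =
  fixes T :: "(int \<Rightarrow> complex) \<Rightarrow> (int \<Rightarrow> complex)"
  assumes unitary: "unitary_on_ell2 T" and bij: "bij T"
begin

lemma power_ell2: "x \<in> ell2 \<Longrightarrow> (T ^^ l) x \<in> ell2"
  using unitary by (induction l) (auto simp: unitary_on_ell2_def dest: bij_betwE)

text \<open>\<open>T\<close> maps \<open>ell2\<close> onto itself, so the preimage of a point of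
  \<open>ell2\<close> under the global bijection lies in \<open>ell2\<close>.\<close>

lemma inv_power_ell2:
  assumes "x \<in> ell2"
  shows "(inv T ^^ l) x \<in> ell2"
proof (induction l)
  case (Suc l)
  then have "(inv T ^^ l) x \<in> T ` ell2"
    using unitary by (simp add: unitary_on_ell2_def bij_betw_def)
  then obtain y where y: "y \<in> ell2" "T y = (inv T ^^ l) x" by auto
  then have "(inv T ^^ Suc l) x = inv T (T y)" by simp
  also have "\<dots> = y" using bij by (simp add: bij_is_inj)
  finally show ?case using y(1) by simp
qed (use assms in simp)

lemma inner_power:
  "x \<in> ell2 \<Longrightarrow> y \<in> ell2 \<Longrightarrow> ell2_inner ((T ^^ l) x) ((T ^^ l) y) = ell2_inner x y"
  using unitary by (induction l) (auto simp: unitary_on_ell2_def power_ell2)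

lemma power_inv_power: "(T ^^ l) ((inv T ^^ l) x) = x"
proof (induction l arbitrary: x)
  case (Suc l)
  have "(T ^^ Suc l) ((inv T ^^ Suc l) x) = (T ^^ l) (T (inv T ((inv T ^^ l) x)))"
    by (simp add: funpow_swap1)
  then show ?case using Suc bij by (simp add: bij_is_surj surj_f_inv_f)
qed simp

lemma entry_int_power_uminus: "entry (int_power T (- l)) n n = cnj (entry (int_power T l) n n)"
proof -
  have "entry (inv T ^^ k) n n = cnj (entry (T ^^ k) n n)" for k
  proof -
    have "ell2_inner (delta n) ((inv T ^^ k) (delta n)) = ell2_inner ((T ^^ k) (delta n)) (delta n)"
      using inner_power[OF delta_in_ell2 inv_power_ell2[OF delta_in_ell2], of k n k n]
      by (simp add: power_inv_power)
    then show ?thesis unfolding entry_def by (metis ell2_inner_commute)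
  qed
  then show ?thesis
    using entry_power_0[of T n]
    by (cases l "0 :: int" rule: linorder_cases) (simp_all add: int_power_def)
qed

text \<open>The moments form the Gram matrix of the orbit of \<open>delta n\<close>, which by
  unitarity is Toeplitz and positive semidefinite, so Herglotz' theorem gives existence. Uniqueness
  holds as Fourier coefficients determine the measure.\<close>

lemma ex1_is_spectral_measure: "\<exists>!\<mu>. is_spectral_measure T n \<mu>"
proof -
  define x where "x j = (T ^^ j) (delta n)" for j
  have x: "x j \<in> ell2" for j unfolding x_def by (intro power_ell2 delta_in_ell2)
  have gram_le: "ell2_inner (x k) (x j) = entry (int_power T (int j - int k)) n n" if "k \<le> j" for j k
  proof -
    have "x j = (T ^^ k) (x (j - k))" using that by (simp add: x_def flip: funpow_add comp_apply[of "T ^^ k"])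
    then have "ell2_inner (x k) (x j) = ell2_inner (delta n) (x (j - k))"
      using inner_power[OF delta_in_ell2 x] by (simp add: x_def)
    then show ?thesis using that by (simp add: entry_def int_power_def x_def nat_diff_distrib)
  qed
  have gram: "ell2_inner (x k) (x j) = entry (int_power T (int j - int k)) n n" for j k
  proof (cases "k \<le> j")
    case False
    then have "ell2_inner (x k) (x j) = cnj (entry (int_power T (int k - int j)) n n)"
      using gram_le[of j k] by (metis ell2_inner_commute nat_le_linear)
    then show ?thesis by (simp flip: entry_int_power_uminus)
  qed (rule gram_le)
  have "\<exists>\<mu>. prob_space \<mu> \<and> sets \<mu> = sets circle \<and>
      (\<forall>l::int. (\<integral>\<theta>. cis (of_int l * \<theta>) \<partial>\<mu>) = entry (int_power T l) n n)"
  proof (rule herglotz)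
    show "entry (int_power T 0) n n = 1" using entry_power_0[of T n] by (simp add: int_power_def)
    show "0 \<le> Re (\<Sum>j<N. \<Sum>k<N. cnj (a k) * a j * entry (int_power T (int j - int k)) n n)" for N a
      using ell2_inner_gram_nonneg[of x a N] x by (simp only: gram)
  qed (rule entry_int_power_uminus)
  then obtain \<mu> where "is_spectral_measure T n \<mu>"
    unfolding is_spectral_measure_def by blast
  then show ?thesis
  proof (rule ex1I)
    fix \<nu> assume "is_spectral_measure T n \<nu>"
    then show "\<nu> = \<mu>"
      using \<open>is_spectral_measure T n \<mu>\<close> unfolding is_spectral_measure_def
      by (intro circle_measure_unique) simp_all
  qed
qed

lemma spectral_measure_moment:
  "(\<integral>\<theta>. cis (real l * \<theta>) \<partial>spectral_measure T n) = entry (T ^^ l) n n"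
proof -
  have "is_spectral_measure T n (spectral_measure T n)"
    unfolding spectral_measure_def by (rule theI') (rule ex1_is_spectral_measure)
  then have "(\<integral>\<theta>. cis (of_int (int l) * \<theta>) \<partial>spectral_measure T n) = entry (int_power T (int l)) n n"
    unfolding is_spectral_measure_def by blast
  then show ?thesis by (simp add: int_power_def)
qed

text \<open>Entries of negative powers are conjugates of those of positive powers, so the predicates
  defining the spectral measures coincide.\<close>

lemma khrushchev_class_if_entries_const:
  assumes "\<And>l n m. entry (T ^^ l) n n = entry (T ^^ l) m m"
  shows "khrushchev_class T"
proof -
  have "entry (int_power T l) n n = entry (int_power T l) m m" for l n m
  proof (cases "l \<ge> 0")
    case True
    then show ?thesis using assms by (simp add: int_power_def)
  next
    case False
    have "entry (int_power T (- l)) n n = entry (int_power T (- l)) m m"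
      using False assms by (simp add: int_power_def)
    then show ?thesis using entry_int_power_uminus[of "- l"] by simp
  qed
  then have "is_spectral_measure T n = is_spectral_measure T m" for n m
    unfolding is_spectral_measure_def fun_eq_iff by metis
  then show ?thesis unfolding khrushchev_class_def spectral_measure_def by metis
qed

end

section \<open>The equivalence\<close>

text \<open>Constancy of \<kappa> makes the moduli agree two sublattice steps apart, giving a and b,
  and t is the argument of \<kappa>. Conversely, the polar form recovers \<kappa> from a, b and
  t.\<close>

lemma sparse_periodic_cond:
  assumes \<alpha>: "\<And>n. cmod (\<alpha> n) \<le> 1" and K: "K \<ge> 1"
  shows "(\<exists>\<kappa>. sparse_periodic \<alpha> K n\<^sub>0 \<kappa>) \<longleftrightarrow>
    (\<exists>(a::real) (b::real) (t::real).
        a \<in> {0<..1} \<and> b \<in> {0<..1} \<and> t \<in> {0..<2 * pi} \<and>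
          (\<forall>n::int.
            cmod (\<alpha> (n\<^sub>0 + 2 * n * int K)) = a \<and>
            cmod (\<alpha> (n\<^sub>0 + (2 * n + 1) * int K)) = b \<and>
            (\<forall>j::nat. 1 \<le> j \<and> j < K \<longrightarrow> \<alpha> (n\<^sub>0 + n * int K + int j) = 0) \<and>
            Arg2pi (cnj (\<alpha> (n\<^sub>0 + (n + 1) * int K)) * \<alpha> (n\<^sub>0 + n * int K)) = t))"
  (is "?L \<longleftrightarrow> ?R")
proof
  assume ?L
  then obtain \<kappa> where sp: "sparse_periodic \<alpha> K n\<^sub>0 \<kappa>" by blast
  define \<beta> where "\<beta> m = \<alpha> (n\<^sub>0 + m * int K)" for m
  have \<kappa>: "\<kappa> \<noteq> 0" and \<beta>: "cnj (\<beta> (m + 1)) * \<beta> m = \<kappa>" for m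
    using sp by (simp_all add: sparse_periodic_def \<beta>_def)
  have nz: "\<beta> m \<noteq> 0" for m using \<kappa> \<beta>[of m] by auto
  have two: "cmod (\<beta> (m + 2)) = cmod (\<beta> m)" for m
  proof -
    have "cmod (\<beta> (m + 1)) * cmod (\<beta> m) = cmod (\<beta> (m + 1)) * cmod (\<beta> (m + 2))"
      using arg_cong[OF \<beta>[of m], of cmod] arg_cong[OF \<beta>[of "m + 1"], of cmod]
      by (simp add: norm_mult mult.commute add.assoc)
    then show ?thesis using nz[of "m + 1"] by simp
  qed
  have "cmod (\<beta> (2 * (n + 1))) = cmod (\<beta> (2 * n))" "cmod (\<beta> (2 * (n + 1) + 1)) = cmod (\<beta> (2 * n + 1))" for n
    using two[of "2 * n"] two[of "2 * n + 1"] by (simp_all add: algebra_simps)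
  then have per: "cmod (\<beta> (2 * n)) = cmod (\<beta> (2 * 0))" "cmod (\<beta> (2 * n + 1)) = cmod (\<beta> (2 * 0 + 1))" for n
    using int_shift_invariant_const[of "\<lambda>n. cmod (\<beta> (2 * n))" n 0]
      int_shift_invariant_const[of "\<lambda>n. cmod (\<beta> (2 * n + 1))" n 0] by simp_all
  show ?R
  proof (rule exI[of _ "cmod (\<beta> 0)"], rule exI[of _ "cmod (\<beta> 1)"], rule exI[of _ "Arg2pi \<kappa>"],
      intro conjI allI impI)
    fix n and j :: nat
    assume j: "1 \<le> j \<and> j < K"
    have "\<not> int K dvd n\<^sub>0 + n * int K + int j - n\<^sub>0"
      using j by (simp add: dvd_add_right_iff) (auto dest: dvd_imp_le)
    then show "\<alpha> (n\<^sub>0 + n * int K + int j) = 0" by (rule sparse_periodic_zero[OF sp])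
  qed (use nz[of 0] nz[of 1] per \<beta> \<alpha> in \<open>simp_all add: Arg2pi_ge_0 Arg2pi_lt_2pi \<beta>_def\<close>)
next
  assume ?R
  then obtain a b t where ab: "a \<in> {0<..1}" "b \<in> {0<..1}" and *:
    "\<And>n. cmod (\<alpha> (n\<^sub>0 + 2 * n * int K)) = a" "\<And>n. cmod (\<alpha> (n\<^sub>0 + (2 * n + 1) * int K)) = b"
    "\<And>n j. 1 \<le> j \<Longrightarrow> j < K \<Longrightarrow> \<alpha> (n\<^sub>0 + n * int K + int j) = 0"
    "\<And>n. Arg2pi (cnj (\<alpha> (n\<^sub>0 + (n + 1) * int K)) * \<alpha> (n\<^sub>0 + n * int K)) = t"
    by blast
  have mods: "cmod (\<alpha> (n\<^sub>0 + n * int K)) = (if even n then a else b)" for n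
  proof (cases "even n")
    case True
    then obtain i where "n = 2 * i" by blast
    then show ?thesis using *(1)[of i] by simp
  next
    case False
    then obtain i where "n = 2 * i + 1" by (rule oddE)
    then show ?thesis using *(2)[of i] by simp
  qed
  have "sparse_periodic \<alpha> K n\<^sub>0 (of_real (a * b) * cis t)"
    unfolding sparse_periodic_def
  proof (intro conjI allI impI)
    fix n
    have "cmod (cnj (\<alpha> (n\<^sub>0 + (n + 1) * int K)) * \<alpha> (n\<^sub>0 + n * int K)) = a * b"
      unfolding norm_mult complex_mod_cnj mods by simp
    then show "cnj (\<alpha> (n\<^sub>0 + (n + 1) * int K)) * \<alpha> (n\<^sub>0 + n * int K) = of_real (a * b) * cis t"
      using Arg2pi_eq[of "cnj (\<alpha> (n\<^sub>0 + (n + 1) * int K)) * \<alpha> (n\<^sub>0 + n * int K)"] *(4)[of n]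
      by (metis cis_conv_exp)
  next
    fix j assume j: "\<not> int K dvd j"
    define i where "i = nat (j mod int K)"
    have "0 \<le> j mod int K" "j mod int K < int K" "j mod int K \<noteq> 0"
      using j K by (simp_all add: dvd_eq_mod_eq_0)
    then have i: "1 \<le> i" "i < K" "int i = j mod int K" by (simp_all add: i_def nat_less_iff)
    have "n\<^sub>0 + j = n\<^sub>0 + (j div int K) * int K + int i" by (simp add: i)
    then show "\<alpha> (n\<^sub>0 + j) = 0" using *(3)[OF i(1,2), of "j div int K"] by (simp only:)
  qed (use ab in simp)
  then show ?L by blast
qed

lemma cmv_bijective_unitary:
  assumes "\<And>n. cmod (\<alpha> n) \<le> 1"
  shows "bijective_unitary (cmv \<alpha>)"
  using assms by (intro bijective_unitary.intro unitary_on_ell2_cmv bij_cmv)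

lemma sparse_periodic_norm_le:
  assumes "\<And>n. cmod (\<alpha> n) \<le> 1" and "sparse_periodic \<alpha> K n\<^sub>0 \<kappa>"
  shows "cmod \<kappa> \<le> 1"
proof -
  have "cnj (\<alpha> (n\<^sub>0 + (0 + 1) * int K)) * \<alpha> (n\<^sub>0 + 0 * int K) = \<kappa>"
    using assms(2) unfolding sparse_periodic_def by blast
  then show ?thesis using assms(1) by (auto simp: norm_mult mult_le_one)
qed

theorem theorem4p6:
  fixes \<alpha> :: "int \<Rightarrow> complex" and k :: enat and \<E> :: "(int \<Rightarrow> complex) \<Rightarrow> (int \<Rightarrow> complex)"
    and \<mu> :: "int \<Rightarrow> real measure"
  assumes "\<And>n. cmod (\<alpha> n) \<le> 1" and "1 \<le> k"
  defines "\<E> \<equiv> cmv \<alpha>"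
  defines "\<mu> \<equiv> (\<lambda>n. spectral_measure \<E> n)"
  defines "i \<equiv>
      khrushchev_class \<E> \<and>
      (\<forall>l::nat. 1 \<le> l \<and> enat l < k \<longrightarrow> (\<forall>n. entry (\<E> ^^ l) n n = 0)) \<and>
      (\<forall>K::nat. k = enat K \<longrightarrow> (\<exists>c\<in>cball 0 1 - {0}. \<forall>n. entry (\<E> ^^ K) n n = c))"
  defines "ii \<equiv>
      (\<forall>l::nat. 1 \<le> l \<and> enat l < k \<longrightarrow> (\<forall>n. (\<integral>\<theta>. cis (real l * \<theta>) \<partial>\<mu> n) = 0)) \<and>
      (\<forall>K::nat. k = enat K \<longrightarrow>
        (\<exists>c\<in>cball 0 1 - {0}. \<forall>n. (\<integral>\<theta>. cis (real K * \<theta>) \<partial>\<mu> n) = c))"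
  defines "iii \<equiv>
      (\<exists>(n\<^sub>0::int) (a::real) (b::real) (t::real).
        a \<in> {0<..1} \<and> b \<in> {0<..1} \<and> t \<in> {0..<2 * pi} \<and>
        (\<forall>K::nat. k = enat K \<longrightarrow>
          (\<forall>n::int.
            cmod (\<alpha> (n\<^sub>0 + 2 * n * int K)) = a \<and>
            cmod (\<alpha> (n\<^sub>0 + (2 * n + 1) * int K)) = b \<and>
            (\<forall>j::nat. 1 \<le> j \<and> j < K \<longrightarrow> \<alpha> (n\<^sub>0 + n * int K + int j) = 0) \<and>
            Arg2pi (cnj (\<alpha> (n\<^sub>0 + (n + 1) * int K)) * \<alpha> (n\<^sub>0 + n * int K)) = t)) \<and>
        (k = \<infinity> \<longrightarrow> (\<forall>j. j \<noteq> n\<^sub>0 \<longrightarrow> \<alpha> j = 0)))"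
  shows "(i \<longleftrightarrow> ii) \<and> (ii \<longleftrightarrow> iii)"
proof -
  interpret bijective_unitary \<E> unfolding \<E>_def by (rule cmv_bijective_unitary) (rule assms(1))
  \<comment> \<open>This is (i) without membership in the class and, by the moment formula, it is
    (ii). What remains is its equivalence with (iii) and that it implies membership.\<close>
  define entries where "entries \<longleftrightarrow>
      (\<forall>l::nat. 1 \<le> l \<and> enat l < k \<longrightarrow> (\<forall>n. entry (\<E> ^^ l) n n = 0)) \<and>
      (\<forall>K::nat. k = enat K \<longrightarrow> (\<exists>c\<in>cball 0 1 - {0}. \<forall>n. entry (\<E> ^^ K) n n = c))"
  have ii_iff: "ii \<longleftrightarrow> entries"
    unfolding ii_def entries_def \<mu>_def spectral_measure_moment ..
  have const_if: "khrushchev_class \<E>" if "\<And>n m. schur \<alpha> n * back_schur \<alpha> n = schur \<alpha> m * back_schur \<alpha> m"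
    using that entry_cong_if_schur_product_eq[of \<alpha>, OF assms(1)] unfolding \<E>_def
    by (intro bijective_unitary.khrushchev_class_if_entries_const cmv_bijective_unitary assms(1)) metis
  have main: "(entries \<longleftrightarrow> iii) \<and> (entries \<longrightarrow> khrushchev_class \<E>)"
  proof (cases k)
    case (enat K)
    then have K: "K \<ge> 1" using assms(2) by (simp add: one_enat_def)
    have iii: "iii \<longleftrightarrow> (\<exists>n\<^sub>0 \<kappa>. sparse_periodic \<alpha> K n\<^sub>0 \<kappa>)"
      unfolding iii_def sparse_periodic_cond[of \<alpha>, OF assms(1) K] by (simp add: enat)
    have entries: "entries \<longleftrightarrow> (\<forall>l. 1 \<le> l \<and> l < K \<longrightarrow> (\<forall>n. entry (\<E> ^^ l) n n = 0)) \<and>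
        (\<exists>c\<in>cball 0 1 - {0}. \<forall>n. entry (\<E> ^^ K) n n = c)"
      unfolding entries_def enat by auto
    have sp_if: "\<exists>n\<^sub>0 \<kappa>. sparse_periodic \<alpha> K n\<^sub>0 \<kappa>" if entries
    proof -
      from that obtain c where c: "c \<noteq> 0" "\<And>n. entry (cmv \<alpha> ^^ K) n n = c"
        and zero: "\<And>l n. 1 \<le> l \<Longrightarrow> l < K \<Longrightarrow> entry (cmv \<alpha> ^^ l) n n = 0"
        unfolding entries \<E>_def by blast
      show ?thesis
        by (rule sparse_periodic_if_entries[of \<alpha> K c, OF assms(1) K c(1) zero c(2)]) blast+
    qed
    have if_sp: "entries \<and> khrushchev_class \<E>" if sp: "sparse_periodic \<alpha> K n\<^sub>0 \<kappa>" for n\<^sub>0 \<kappa>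
    proof
      have "- \<kappa> \<in> cball 0 1 - {0}"
        using sparse_periodic_norm_le[of \<alpha>, OF assms(1) sp] sp by (simp add: sparse_periodic_def)
      then show entries
        unfolding entries \<E>_def using sparse_periodic_entries[of \<alpha>, OF assms(1) K sp] by blast
      show "khrushchev_class \<E>"
        by (rule const_if) (rule sparse_periodic_schur_product_const[OF sp])
    qed
    show ?thesis unfolding iii using sp_if if_sp by blast
  next
    case infinity
    have iii: "iii \<longleftrightarrow> (\<exists>n\<^sub>0. \<forall>j. j \<noteq> n\<^sub>0 \<longrightarrow> \<alpha> j = 0)"
    proof
      assume "\<exists>n\<^sub>0. \<forall>j. j \<noteq> n\<^sub>0 \<longrightarrow> \<alpha> j = 0"
      then obtain n\<^sub>0 where "\<forall>j. j \<noteq> n\<^sub>0 \<longrightarrow> \<alpha> j = 0" by blast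
      \<comment> \<open>For infinite k only \<open>n\<^sub>0\<close> is tied to \<alpha>; fixed
        numbers in the allowed ranges serve for a, b and t.\<close>
      then show iii
        unfolding iii_def infinity
        by (intro exI[of _ n\<^sub>0] exI[of _ "1::real"] exI[of _ "0::real"]) simp
    qed (auto simp: iii_def infinity)
    have entries: "entries \<longleftrightarrow> (\<forall>l\<ge>1. \<forall>n. entry (cmv \<alpha> ^^ l) n n = 0)"
      unfolding entries_def infinity \<E>_def by simp
    \<comment> \<open>At every site the diagonal entry is 1 for the zeroth power and 0 for all later
      ones.\<close>
    have "khrushchev_class \<E>" if entries
    proof (rule khrushchev_class_if_entries_const)
      fix l n m
      show "entry (\<E> ^^ l) n n = entry (\<E> ^^ l) m m"
        using that entry_power_0[of \<E>] unfolding entries \<E>_def by (cases l) (simp_all del: funpow.simps)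
    qed
    then show ?thesis
      unfolding iii using entries_vanish_all_iff[of \<alpha>, OF assms(1)] entries by blast
  qed
  then show ?thesis unfolding ii_iff using i_def entries_def by blast
qed

end
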